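(* Let $n\ge 1$ be an integer and let $X=\{1,2,\dots,n\}$. Then the poset of ranked cactuses $(\mathfrak{P}(X),\preceq)$ is EL-shellable.
   Context: **The poset.** A *set pair* on $X$ is an ordered pair $(S,H)$ of subsets of $X$. A *set pair system* on $X$ is a collection (set) $\mathcal{S}$ of set pairs $(S,H)$ on $X$ with $S\neq\emptyset$ and $S\cap H=\emptyset$. For a set pair system $\mathcal{S}$ put $\mathcal{P}(\mathcal{S})=\{S:(S,H)\in\mathcal{S}\}$. A set pair system $\mathcal{S}$ is *partition-like* if - (PL1) $\mathcal{P}(\mathcal{S})$ is a partition of $X$; - (PL2) for all $(S,H),(S',H')\in\mathcal{S}$ with $(S,H)\neq(S',H')$ we have $S\neq S'$; - (PL3) for all $(S,H)\in\mathcal{S}$ with $H\neq\emptyset$ we have $(H,\emptyset)\in\mathcal{S}$, and there exists precisely one $(\overline{S},\overline{H})\in\mathcal{S}$ with $(\overline{S},\overline{H})\neq(S,H)$ and $\overline{H}=H$. $\mathfrak{P}(X)$ is the set of all partition-like set pair systems on $X$. For set pairs, $(S_1,H_1)\leq(S_2,H_2)$ means that either $(S_1,H_1)=(S_2,H_2)$, or $(S_1,H_1)\ne(S_2,H_2)$ and one of the following holds: $S_1\cup H_1\subseteq S_2$; or $S_1\subsetneq S_2$ and $H_1=H_2\neq\emptyset$. For $\mathcal{S}_1,\mathcal{S}_2\in\mathfrak{P}(X)$, $\mathcal{S}_1\preceq\mathcal{S}_2$ means that - (SP1) for all $(S_1,H_1)\in\mathcal{S}_1$ there exists $(S_2,H_2)\in\mathcal{S}_2$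 with $(S_1,H_1)\leq(S_2,H_2)$; and - (SP2) for all $(S_2,H_2)\in\mathcal{S}_2$ with $H_2\neq\emptyset$, if there exists some $(S_1,H_1)\in\mathcal{S}_1$ with $H_1=H_2$, then there exists such an $(S_1,H_1)$ (i.e. in $\mathcal S_1$ with $H_1=H_2$) with $(S_1,H_1)\leq(S_2,H_2)$. It is known that $(\mathfrak{P}(X),\preceq)$ is a bounded graded poset with minimum $\{(\{x\},\emptyset):x\in X\}$, maximum $\{(X,\emptyset)\}$, and all maximal chains of length $n-1$. **EL-shellability.** Let $(M,\leq)$ be a finite poset. It is *bounded* if it has a maximum and a minimum. The *length* of a chain $\mathfrak{C}$ (a non-empty totally ordered subset) is $|\mathfrak{C}|-1$; a bounded poset is *graded* if all its maximal chains have the same length. For distinct $a\leq b$ in $M$, the *interval* $[a,b]$ is $\{e\in M:a\leq e\leq b\}$; a chain contained in an interval $\mathfrak{I}$ is *maximal in* $\mathfrak{I}$ if no element of $\mathfrak{I}$ can be added to it to give a larger chain. The *edge set* $\mathfrak{E}_{(M,\leq)}$ is the set of pairs $(a,b)$ (with $a\le b$, $a\neq b$) with $|[a,b]|=2$, i.e. the covering relation. An *edge-labeling* is a map $\lambda:\mathfrak{E}_{(M,\leq)}\to\mathbb{N}$. For a chain $\mathfrak{C}=\{e_0\leq e_1\leq\dots\leq e_k\}$ of length $k\geq1$ that is maximal in an interval (so consecutive elements form edges), its label vector is $\Lambda_\lambda(\mathfrak{C})=(\lambda(e_0,e_1),\dots,\lambda(e_{k-1},e_k))$; $\mathfrak{C}$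 is *increasing* with respect to $\lambda$ if the entries of this vector are strictly increasing from first to last. Vectors in $\mathbb{N}^k$ are compared lexicographically: $u<_{\mathrm{lex}}v$ if $u\neq v$ and $u_i<v_i$ for the smallest $i$ with $u_i\neq v_i$. A finite, bounded, graded poset $(M,\leq)$ is *EL-shellable* if there exists an edge-labeling $\lambda$ such that - (EL1) for every interval $\mathfrak{I}$ of $(M,\leq)$ with $|\mathfrak{I}|\geq2$ there is precisely one maximal chain $\mathfrak{C}_{\mathfrak{I}}$ in $\mathfrak{I}$ that is increasing with respect to $\lambda$; and - (EL2) $\Lambda_\lambda(\mathfrak{C}_{\mathfrak{I}})$ is lexicographically strictly smaller than the label vector of any other maximal chain in $\mathfrak{I}$. *)

theory Defs
  imports Main "HOL-Library.Disjoint_Sets"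
begin

section \<open>EL-shellable posets\<close>

text \<open>A poset is given by a carrier \<open>M\<close> and a relation \<open>r\<close> with
  \<^term>\<open>partial_order_on M r\<close>; \<open>(a, b) \<in> r\<close> stands for \<open>a \<le> b\<close>.\<close>

definition bounded_poset :: "'a set \<Rightarrow> 'a rel \<Rightarrow> bool" where
  "bounded_poset M r \<longleftrightarrow>
     (\<exists>bot\<in>M. \<forall>a\<in>M. (bot, a) \<in> r) \<and> (\<exists>top\<in>M. \<forall>a\<in>M. (a, top) \<in> r)"

definition is_chain :: "'a rel \<Rightarrow> 'a set \<Rightarrow> bool" where
  "is_chain r C \<longleftrightarrow> C \<noteq> {} \<and> C \<in> Chains r"

definition chain_length :: "'a set \<Rightarrow> nat" where
  "chain_length C = card C - 1"

definition maximal_chain_in :: "'a rel \<Rightarrow> 'a set \<Rightarrow> 'a set \<Rightarrow> bool" where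
  "maximal_chain_in r A C \<longleftrightarrow>
     C \<subseteq> A \<and> is_chain r C \<and> (\<forall>e\<in>A - C. \<not> is_chain r (insert e C))"

definition graded_poset :: "'a set \<Rightarrow> 'a rel \<Rightarrow> bool" where
  "graded_poset M r \<longleftrightarrow>
     (\<forall>C D. maximal_chain_in r M C \<and> maximal_chain_in r M D \<longrightarrow>
        chain_length C = chain_length D)"

definition poset_interval :: "'a set \<Rightarrow> 'a rel \<Rightarrow> 'a \<Rightarrow> 'a \<Rightarrow> 'a set" where
  "poset_interval M r a b = {e \<in> M. (a, e) \<in> r \<and> (e, b) \<in> r}"

text \<open>The enumeration \<open>[e\<^sub>0, \<dots>, e\<^sub>k]\<close> of a finite chain in strictly increasing order.\<close>

definition chain_list :: "'a rel \<Rightarrow> 'a set \<Rightarrow> 'a list" where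
  "chain_list r C = (THE es. set es = C \<and> sorted_wrt (\<lambda>a b. (a, b) \<in> r \<and> a \<noteq> b) es)"

text \<open>An edge-labeling is represented by a total function on pairs. Only its values on
  covering pairs matter: label vectors are used below only for maximal chains of
  intervals, whose consecutive elements are covering pairs.\<close>

definition label_vector :: "'a rel \<Rightarrow> ('a \<times> 'a \<Rightarrow> nat) \<Rightarrow> 'a set \<Rightarrow> nat list" where
  "label_vector r lab C = (let es = chain_list r C in map lab (zip es (tl es)))"

definition increasing_chain :: "'a rel \<Rightarrow> ('a \<times> 'a \<Rightarrow> nat) \<Rightarrow> 'a set \<Rightarrow> bool" where
  "increasing_chain r lab C \<longleftrightarrow> sorted_wrt (<) (label_vector r lab C)"

text \<open>The intervals \<open>[a, b]\<close> are those with \<open>a \<le> b\<close> and \<open>a \<noteq> b\<close>, so each has at least two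
  elements. \<^term>\<open>lex less_than\<close> is the strict lexicographic order on lists of equal
  length.\<close>

definition EL_labeling :: "'a set \<Rightarrow> 'a rel \<Rightarrow> ('a \<times> 'a \<Rightarrow> nat) \<Rightarrow> bool" where
  "EL_labeling M r lab \<longleftrightarrow>
     (\<forall>a\<in>M. \<forall>b\<in>M. (a, b) \<in> r \<and> a \<noteq> b \<longrightarrow>
        (let I = poset_interval M r a b in
           (\<exists>!C. maximal_chain_in r I C \<and> increasing_chain r lab C) \<and>
           (\<forall>C D. maximal_chain_in r I C \<and> increasing_chain r lab C \<and>
                  maximal_chain_in r I D \<and> D \<noteq> C \<longrightarrow>
                  (label_vector r lab C, label_vector r lab D) \<in> lex less_than)))"

definition EL_shellable :: "'a set \<Rightarrow> 'a rel \<Rightarrow> bool" where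
  "EL_shellable M r \<longleftrightarrow>
     finite M \<and> partial_order_on M r \<and> bounded_poset M r \<and> graded_poset M r \<and>
     (\<exists>lab. EL_labeling M r lab)"


section \<open>The poset of partition-like set pair systems (ranked cactuses)\<close>

type_synonym 'a set_pair = "'a set \<times> 'a set"

definition set_pair_system :: "'a set \<Rightarrow> 'a set_pair set \<Rightarrow> bool" where
  "set_pair_system X \<S> \<longleftrightarrow>
     (\<forall>(S, H)\<in>\<S>. S \<subseteq> X \<and> H \<subseteq> X \<and> S \<noteq> {} \<and> S \<inter> H = {})"

definition partition_like :: "'a set \<Rightarrow> 'a set_pair set \<Rightarrow> bool" where
  "partition_like X \<S> \<longleftrightarrow>
     set_pair_system X \<S> \<and>
     partition_on X (fst ` \<S>) \<and>
     (\<forall>(S, H)\<in>\<S>. \<forall>(S', H')\<in>\<S>. (S, H) \<noteq> (S', H') \<longrightarrow> S \<noteq> S') \<and>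
     (\<forall>(S, H)\<in>\<S>. H \<noteq> {} \<longrightarrow>
        (H, {}) \<in> \<S> \<and> (\<exists>!q. q \<in> \<S> \<and> q \<noteq> (S, H) \<and> snd q = H))"

definition partition_like_systems :: "'a set \<Rightarrow> 'a set_pair set set" where
  "partition_like_systems X = {\<S>. partition_like X \<S>}"

fun set_pair_le :: "'a set_pair \<Rightarrow> 'a set_pair \<Rightarrow> bool" where
  "set_pair_le (S1, H1) (S2, H2) \<longleftrightarrow>
     (S1, H1) = (S2, H2) \<or>
     (S1, H1) \<noteq> (S2, H2) \<and>
       (S1 \<union> H1 \<subseteq> S2 \<or> S1 \<subset> S2 \<and> H1 = H2 \<and> H2 \<noteq> {})"

definition system_le :: "'a set_pair set \<Rightarrow> 'a set_pair set \<Rightarrow> bool" where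
  "system_le \<S>1 \<S>2 \<longleftrightarrow>
     (\<forall>p1\<in>\<S>1. \<exists>p2\<in>\<S>2. set_pair_le p1 p2) \<and>
     (\<forall>p2\<in>\<S>2. snd p2 \<noteq> {} \<longrightarrow>
        (\<exists>p1\<in>\<S>1. snd p1 = snd p2) \<longrightarrow>
        (\<exists>p1\<in>\<S>1. snd p1 = snd p2 \<and> set_pair_le p1 p2))"

definition ranked_cactus_order :: "'a set \<Rightarrow> 'a set_pair set rel" where
  "ranked_cactus_order X = relation_of system_le (partition_like_systems X)"

end

theory Submission
  imports Defs
begin

text \<open>
  A partition-like system is a partition of \<open>X\<close> together with pairwise disjoint triples of blocks:
  a \<^emph>\<open>hybrid\<close> \<open>H\<close> and its two \<^emph>\<open>sides\<close>, the blocks whose second component is \<open>H\<close>. Going up in the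
  order, three elementary moves suffice: \<^emph>\<open>collapse\<close> a triple into one block; \<^emph>\<open>merge\<close> two blocks that
  are not hybrids and of which at most one is a side; \<^emph>\<open>spawn\<close> a triple from three blocks that belong
  to no triple. Each of them raises the number of triples minus the number of blocks by one. A block
  cannot grow while it is a hybrid; when its triple is lost, it is absorbed by a larger block, so it
  never becomes a hybrid again.

  Label a collapse of a triple with hybrid \<open>H\<close> by \<open>Min H\<close>, a merge by \<open>n\<close> plus the larger of the two
  block minima (as in the classical labeling of the partition lattice), and the spawning of a
  triple with hybrid \<open>H\<close> by \<open>2 * n + Min H\<close>. A strictly increasing chain from \<open>a\<close> to \<open>b\<close> then has no
  freedom: it collapses all triples of \<open>a\<close> that are not triples of \<open>b\<close>, then merges, then
  spawns the triples of \<open>b\<close> that are not triples of \<open>a\<close>, each phase in the order of the minima.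

  To avoid reasoning about whole chains, the labels are extended to all pairs \<open>a < b\<close>: the label of
  \<open>(a, b)\<close> is the smallest label of a move that leads from \<open>a\<close> towards \<open>b\<close>. Two local properties of
  this function imply that the greedy chain, which always takes the move of least label, is the only
  increasing one and lexicographically first. (i) Exactly one cover \<open>x\<close> of \<open>a\<close> in \<open>[a, b]\<close> carries
  the label of \<open>(a, b)\<close>, and \<open>(x, b)\<close> has a larger label unless \<open>x = b\<close> (lemmas \<open>least_step_lost\<close>,
  \<open>least_step_gone\<close>, \<open>least_step_new\<close>). (ii) If an intermediate \<open>y\<close> is reached with a label larger
  than that of \<open>(a, b)\<close>, then \<open>(y, b)\<close> has a label at most as large as that of \<open>(a, y)\<close>, so any chain
  through such a first step has a non-ascent (lemma \<open>lab_triangle\<close>). The locale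
  \<open>least_label_poset\<close> derives EL-shellability from (i) and (ii); the same data yield gradedness.
\<close>

section \<open>A local criterion for EL-shellability\<close>

text \<open>
  Here \<open>f\<close> is defined on all comparable pairs, and \<open>f (a, b)\<close> is meant to be the smallest label of an
  edge from \<open>a\<close> within \<open>[a, b]\<close>. Since \<open>rk\<close> increases by exactly one in \<open>step\<close>, the
  element \<open>x\<close> found there covers \<open>a\<close>; the last clause says that it is the only cover of \<open>a\<close> with this label.
\<close>

locale least_label_poset =
  fixes M :: "'a set" and r :: "'a rel" and rk :: "'a \<Rightarrow> int" and f :: "'a \<times> 'a \<Rightarrow> nat"
  assumes finite_carrier: "finite M"
    and po: "partial_order_on M r"
    and step: "\<And>a b. (a, b) \<in> r \<Longrightarrow> a \<noteq> b \<Longrightarrow>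
      \<exists>x. (a, x) \<in> r \<and> a \<noteq> x \<and> (x, b) \<in> r \<and> rk x = rk a + 1 \<and> f (a, x) = f (a, b) \<and>
        (x \<noteq> b \<longrightarrow> f (a, b) < f (x, b)) \<and>
        (\<forall>y. (a, y) \<in> r \<and> a \<noteq> y \<and> (y, b) \<in> r \<and> f (a, y) = f (a, b) \<longrightarrow> (x, y) \<in> r)"
    and triangle: "\<And>a y b. (a, y) \<in> r \<Longrightarrow> a \<noteq> y \<Longrightarrow> (y, b) \<in> r \<Longrightarrow> y \<noteq> b \<Longrightarrow>
      f (a, b) \<le> f (a, y) \<and> (f (a, y) = f (a, b) \<or> f (y, b) \<le> f (a, y))"
begin

definition covers :: "'a \<Rightarrow> 'a \<Rightarrow> bool" where
  "covers a b \<longleftrightarrow> (a, b) \<in> r \<and> a \<noteq> b \<and> (\<forall>c. (a, c) \<in> r \<and> (c, b) \<in> r \<longrightarrow> c = a \<or> c = b)"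

text \<open>The list in \<open>path\<close> and \<open>labels\<close> omits the starting point \<open>a\<close>, so that a path and its label
  vector have the same length.\<close>

primrec path :: "'a \<Rightarrow> 'a list \<Rightarrow> 'a \<Rightarrow> bool" where
  "path a [] b \<longleftrightarrow> a = b"
| "path a (x # xs) b \<longleftrightarrow> covers a x \<and> path x xs b"

primrec labels :: "'a \<Rightarrow> 'a list \<Rightarrow> nat list" where
  "labels a [] = []"
| "labels a (x # xs) = f (a, x) # labels x xs"

lemma refl_r: "a \<in> M \<Longrightarrow> (a, a) \<in> r"
  using po by (auto simp: partial_order_on_def preorder_on_def refl_on_def)

lemma trans_r: "(a, b) \<in> r \<Longrightarrow> (b, c) \<in> r \<Longrightarrow> (a, c) \<in> r"
  using po by (auto simp: partial_order_on_def preorder_on_def dest: transD)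

lemma antisym_r: "(a, b) \<in> r \<Longrightarrow> (b, a) \<in> r \<Longrightarrow> a = b"
  using po by (auto simp: partial_order_on_def dest: antisymD)

lemma in_carrier: "(a, b) \<in> r \<Longrightarrow> a \<in> M \<and> b \<in> M"
  using po by (auto simp: partial_order_on_def preorder_on_def refl_on_def)

abbreviation interval :: "'a \<Rightarrow> 'a \<Rightarrow> 'a set" where
  "interval a b \<equiv> poset_interval M r a b"

lemma interval_iff: "e \<in> interval a b \<longleftrightarrow> (a, e) \<in> r \<and> (e, b) \<in> r"
  using in_carrier by (auto simp: poset_interval_def)

lemma finite_interval: "finite (interval a b)"
  using finite_carrier by (simp add: poset_interval_def)

lemma interval_shrinks:
  assumes "(a, x) \<in> r" "a \<noteq> x" "(x, b) \<in> r"
  shows "card (interval x b) < card (interval a b)"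
proof (rule psubset_card_mono[OF finite_interval])
  have "a \<in> interval a b" "a \<notin> interval x b"
    using assms in_carrier[OF assms(1)] refl_r[of a] trans_r[OF assms(1,3)] antisym_r[OF assms(1)]
    by (auto simp: interval_iff)
  moreover have "interval x b \<subseteq> interval a b"
    using trans_r[OF assms(1)] by (auto simp: interval_iff)
  ultimately show "interval x b \<subset> interval a b" by blast
qed

text \<open>Stepping repeatedly towards \<open>b\<close> raises the rank by one each time.\<close>

lemma rank_strict_mono: "(a, b) \<in> r \<Longrightarrow> a \<noteq> b \<Longrightarrow> rk a < rk b"
proof (induction "card (interval a b)" arbitrary: a rule: less_induct)
  case less
  obtain x where x: "(a, x) \<in> r" "a \<noteq> x" "(x, b) \<in> r" "rk x = rk a + 1"
    using step[OF less.prems] by blast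
  show ?case
    using less.hyps[OF interval_shrinks[OF x(1-3)] x(3)] x(4) by (cases "x = b") auto
qed

lemma covers_if_rank_Suc:
  assumes "(a, x) \<in> r" "a \<noteq> x" "rk x = rk a + 1"
  shows "covers a x"
  unfolding covers_def
proof (intro conjI allI impI, rule assms(1), rule assms(2))
  fix c assume c: "(a, c) \<in> r \<and> (c, x) \<in> r"
  then show "c = a \<or> c = x"
    using rank_strict_mono[of a c] rank_strict_mono[of c x] assms(3) by (cases "a = c") auto
qed

lemma covers_rank: "covers a b \<Longrightarrow> rk b = rk a + 1"
  using step[of a b] unfolding covers_def by metis

lemma path_le: "a \<in> M \<Longrightarrow> path a xs b \<Longrightarrow> (a, b) \<in> r"
proof (induction xs arbitrary: a)
  case (Cons x xs)
  then have "(a, x) \<in> r" by (simp add: covers_def)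
  then show ?case using Cons in_carrier[of a x] trans_r[of a x b] by auto
qed (simp add: refl_r)

lemma path_length: "path a xs b \<Longrightarrow> int (length xs) = rk b - rk a"
  by (induction xs arbitrary: a) (auto dest: covers_rank)

lemma length_labels [simp]: "length (labels a xs) = length xs"
  by (induction xs arbitrary: a) auto

lemma path_refl: "a \<in> M \<Longrightarrow> path a xs a \<Longrightarrow> xs = []"
  using path_length[of a xs a] by simp

text \<open>The greedy path repeats the step of least label; by \<open>step\<close> its labels increase. A competing path
  that leaves it at \<open>a\<close> for some \<open>y\<close> has a strictly larger first label, hence is lexicographically
  larger. If it were increasing, its remainder would by induction be the greedy path from \<open>y\<close>, which
  starts with the label \<open>f (y, b)\<close>; but \<open>triangle\<close> bounds this by \<open>f (a, y)\<close>.\<close>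

lemma least_label_path:
  assumes "(a, b) \<in> r" "a \<noteq> b"
  shows "\<exists>xs. path a xs b \<and> sorted_wrt (<) (labels a xs) \<and> hd (labels a xs) = f (a, b) \<and>
    (\<forall>ys. path a ys b \<and> ys \<noteq> xs \<longrightarrow>
      \<not> sorted_wrt (<) (labels a ys) \<and> (labels a xs, labels a ys) \<in> lex less_than)"
  using assms
proof (induction "card (interval a b)" arbitrary: a rule: less_induct)
  case less
  obtain x where x: "(a, x) \<in> r" "a \<noteq> x" "(x, b) \<in> r" "rk x = rk a + 1" "f (a, x) = f (a, b)"
    and x_less: "x \<noteq> b \<Longrightarrow> f (a, b) < f (x, b)"
    and x_least: "\<And>y. (a, y) \<in> r \<Longrightarrow> a \<noteq> y \<Longrightarrow> (y, b) \<in> r \<Longrightarrow> f (a, y) = f (a, b) \<Longrightarrow> (x, y) \<in> r"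
    using step[OF less.prems] by blast
  have cov: "covers a x" using covers_if_rank_Suc x by blast
  have mem: "a \<in> M" "x \<in> M" "b \<in> M" using in_carrier x by auto
  obtain xs where xs: "path x xs b" "sorted_wrt (<) (labels a (x # xs))"
    and xs_min: "\<And>ys. path x ys b \<Longrightarrow> ys \<noteq> xs \<Longrightarrow>
      \<not> sorted_wrt (<) (labels x ys) \<and> (labels x xs, labels x ys) \<in> lex less_than"
  proof (cases "x = b")
    case True
    then show thesis using that[of "[]"] path_refl mem by auto
  next
    case False
    obtain xs where xs: "path x xs b" "sorted_wrt (<) (labels x xs)"
      "hd (labels x xs) = f (x, b)"
      and min: "\<forall>ys. path x ys b \<and> ys \<noteq> xs \<longrightarrow>
      \<not> sorted_wrt (<) (labels x ys) \<and> (labels x xs, labels x ys) \<in> lex less_than"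
      using less.hyps[OF interval_shrinks[OF x(1-3)] x(3) False] by blast
    have "sorted_wrt (<) (labels a (x # xs))"
      using xs x_less[OF False] x(5) by (cases xs) auto
    then show thesis using that xs(1) min by blast
  qed
  have "\<not> sorted_wrt (<) (labels a ys) \<and> (labels a (x # xs), labels a ys) \<in> lex less_than"
    if "path a ys b" "ys \<noteq> x # xs" for ys
  proof -
    from that less.prems obtain y zs where ys: "ys = y # zs" "covers a y" "path y zs b"
      by (cases ys) auto
    have y: "(a, y) \<in> r" "a \<noteq> y" using ys(2) by (auto simp: covers_def)
    have yb: "(y, b) \<in> r" using path_le[OF _ ys(3)] in_carrier[OF y(1)] by blast
    note y = y yb
    have len: "length xs = length zs"
      using path_length[of a ys b] path_length[of a "x # xs" b] that(1) cov xs(1) ys(1) by simp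
    \<comment> \<open>If \<open>y = x\<close>, the paths diverge later and the choice of \<open>xs\<close> applies.\<close>
    show ?thesis
    proof (cases "y = x")
      case True
      then show ?thesis using xs_min[of zs] ys that(2) by simp
    next
      case False
      have "\<not> (x, y) \<in> r" using ys(2) x(1,2) False unfolding covers_def by blast
      then have ne: "f (a, y) \<noteq> f (a, b)" using x_least y by blast
      then have "y \<noteq> b" by auto
      then have f: "f (a, b) < f (a, y)" "f (y, b) \<le> f (a, y)"
        using triangle[OF y] ne by auto
      have "\<not> sorted_wrt (<) (labels a ys)"
      proof
        assume s: "sorted_wrt (<) (labels a ys)"
        then have "sorted_wrt (<) (labels y zs)" using ys by simp
        then have "hd (labels y zs) = f (y, b)"
          using less.hyps[OF interval_shrinks[OF y] y(3) \<open>y \<noteq> b\<close>] ys(3) by blast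
        moreover have "zs \<noteq> []" using ys \<open>y \<noteq> b\<close> by auto
        ultimately show False using s ys(1) f(2) by (cases zs) auto
      qed
      then show ?thesis using ys(1) f(1) x(5) len by simp
    qed
  qed
  moreover have "path a (x # xs) b" "hd (labels a (x # xs)) = f (a, b)" using cov xs(1) x(5) by simp_all
  ultimately show ?case using xs(2) by blast
qed

lemma path_in_interval: "a \<in> M \<Longrightarrow> path a xs b \<Longrightarrow> set (a # xs) \<subseteq> interval a b"
proof (induction xs arbitrary: a)
  case (Cons x xs)
  have ax: "(a, x) \<in> r" using Cons.prems by (simp add: covers_def)
  then have "set (x # xs) \<subseteq> interval x b" using Cons in_carrier[of a x] by auto
  then have "set (x # xs) \<subseteq> interval a b"
    using trans_r[OF ax] unfolding subset_iff interval_iff by blast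
  then show ?case
    using path_le[OF Cons.prems] refl_r[OF Cons.prems(1)] by (auto simp: interval_iff)
qed (simp add: interval_iff refl_r)

lemma path_sorted:
  "a \<in> M \<Longrightarrow> path a xs b \<Longrightarrow> sorted_wrt (\<lambda>c d. (c, d) \<in> r \<and> c \<noteq> d) (a # xs)"
proof (induction xs arbitrary: a)
  case (Cons x xs)
  have ax: "(a, x) \<in> r" "a \<noteq> x" using Cons.prems by (auto simp: covers_def)
  then have x: "x \<in> M" using in_carrier by blast
  then have "set (x # xs) \<subseteq> interval x b" using path_in_interval[of x xs b] Cons.prems by simp
  then have "\<forall>e\<in>set (x # xs). (a, e) \<in> r \<and> a \<noteq> e"
    using trans_r[OF ax(1)] antisym_r[OF ax(1)] ax(2) unfolding subset_iff interval_iff by blast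
  then show ?case using Cons x by simp
qed simp

lemma sorted_unique:
  assumes "sorted_wrt (\<lambda>c d. (c, d) \<in> r \<and> c \<noteq> d) xs" "sorted_wrt (\<lambda>c d. (c, d) \<in> r \<and> c \<noteq> d) ys"
    "set xs = set ys"
  shows "xs = ys"
  using assms
proof (induction xs arbitrary: ys)
  case (Cons x xs)
  then obtain y zs where ys: "ys = y # zs" by (cases ys) auto
  have "x = y"
  proof (rule ccontr)
    assume "x \<noteq> y"
    then have "y \<in> set xs" "x \<in> set zs" using Cons.prems(3) ys by auto
    then show False using Cons.prems(1,2) ys antisym_r[of x y] by auto
  qed
  then have "set xs = set zs" using Cons.prems ys by auto
  then show ?case using Cons ys \<open>x = y\<close> by auto
qed simp

lemma chain_list_path: "a \<in> M \<Longrightarrow> path a xs b \<Longrightarrow> chain_list r (set (a # xs)) = a # xs"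
  unfolding chain_list_def
  by (rule the_equality) (use path_sorted sorted_unique in blast)+

lemma label_vector_path:
  assumes "a \<in> M" "path a xs b"
  shows "label_vector r f (set (a # xs)) = labels a xs"
proof -
  have "map f (zip (a # xs) xs) = labels a xs" by (induction xs arbitrary: a) auto
  then show ?thesis using chain_list_path[OF assms] by (simp add: label_vector_def Let_def)
qed

lemma is_chain_iff: "is_chain r C \<longleftrightarrow> C \<noteq> {} \<and> (\<forall>c\<in>C. \<forall>d\<in>C. (c, d) \<in> r \<or> (d, c) \<in> r)"
  by (auto simp: is_chain_def Chains_def)

lemma path_is_chain: 
  assumes "a \<in> M" "path a xs b"
  shows "is_chain r (set (a # xs))"
proof -
  have "\<And>ys. sorted_wrt (\<lambda>c d. (c, d) \<in> r \<and> c \<noteq> d) ys \<Longrightarrow> set ys \<subseteq> M \<Longrightarrow>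
    \<forall>c\<in>set ys. \<forall>d\<in>set ys. (c, d) \<in> r \<or> (d, c) \<in> r"
    subgoal for ys by (induction ys) (auto simp: refl_r)
    done
  then show ?thesis
    using path_sorted[OF assms] path_in_interval[OF assms] unfolding is_chain_iff poset_interval_def by blast
qed

text \<open>An element comparable to all members of a path would have to lie strictly inside one of its covering
  pairs, so it is itself a member.\<close>

lemma path_contains:
  assumes "path a xs b" "e \<in> interval a b" "\<forall>c\<in>set (a # xs). (c, e) \<in> r \<or> (e, c) \<in> r"
  shows "e \<in> set (a # xs)"
  using assms
proof (induction xs arbitrary: a)
  case Nil
  then show ?case using antisym_r[of a e] by (simp add: interval_iff)
next
  case (Cons x xs)
  then show ?case
  proof (cases "(x, e) \<in> r")
    case True
    then show ?thesis using Cons by (auto simp: interval_iff)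
  next
    case False
    then show ?thesis using Cons.prems by (auto simp: interval_iff covers_def)
  qed
qed

lemma path_maximal_chain:
  assumes "a \<in> M" "path a xs b"
  shows "maximal_chain_in r (interval a b) (set (a # xs))"
proof -
  have "\<not> is_chain r (insert e (set (a # xs)))" if "e \<in> interval a b - set (a # xs)" for e
    using path_contains[OF assms(2), of e] that unfolding is_chain_iff by blast
  then show ?thesis
    unfolding maximal_chain_in_def using path_is_chain[OF assms] path_in_interval[OF assms] by blast
qed

lemma chain_least:
  assumes "finite C" "is_chain r C"
  shows "\<exists>y\<in>C. \<forall>c\<in>C. (y, c) \<in> r"
proof -
  have "C \<noteq> {}" using assms by (simp add: is_chain_iff)
  with assms(1) have "(\<forall>c\<in>C. \<forall>d\<in>C. (c, d) \<in> r \<or> (d, c) \<in> r) \<Longrightarrow> \<exists>y\<in>C. \<forall>c\<in>C. (y, c) \<in> r"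
  proof (induction C rule: finite_ne_induct)
    case (insert x F)
    then obtain y where "y \<in> F" "\<forall>c\<in>F. (y, c) \<in> r" by auto
    moreover have "(x, x) \<in> r" using insert.prems by blast
    ultimately show ?case using insert.prems trans_r[of x y] by (cases "(x, y) \<in> r") blast+
  qed auto
  then show ?thesis using assms(2) by (simp add: is_chain_iff)
qed

text \<open>A maximal chain of \<open>[a, b]\<close> contains \<open>a\<close>; what remains has a least element \<open>y\<close>, which covers \<open>a\<close>
  because the chain cannot be extended, and is a maximal chain of \<open>[y, b]\<close>.\<close>

lemma maximal_chain_path:
  assumes "(a, b) \<in> r" "maximal_chain_in r (interval a b) C"
  shows "\<exists>xs. path a xs b \<and> C = set (a # xs)"
  using assms
proof (induction "card (interval a b)" arbitrary: a C rule: less_induct)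
  case less
  note max = less.prems(2)[unfolded maximal_chain_in_def]
  have C_sub: "C \<subseteq> interval a b" and ch: "is_chain r C" using max by auto
  have mem: "a \<in> M" "b \<in> M" using less.prems in_carrier by auto
  have add: "e \<in> C" if "e \<in> interval a b" "\<And>c. c \<in> C \<Longrightarrow> (c, e) \<in> r \<or> (e, c) \<in> r" for e
  proof (rule ccontr)
    assume "e \<notin> C"
    then have "\<not> is_chain r (insert e C)" using max that by blast
    then show False
      using that ch refl_r in_carrier unfolding is_chain_iff interval_iff by blast
  qed
  have a: "a \<in> C" and b: "b \<in> C"
    using add[of a] add[of b] C_sub less.prems(1) refl_r mem unfolding subset_iff interval_iff
    by blast+
  show ?case
  proof (cases "a = b")
    case True
    then have "C = {a}" using C_sub a antisym_r[of a] unfolding subset_iff interval_iff by blast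
    then show ?thesis using True by (intro exI[of _ "[]"]) simp
  next
    case False
    let ?D = "C - {a}"
    have D: "is_chain r ?D" using ch b False by (auto simp: is_chain_iff)
    have "finite ?D" using finite_subset[OF C_sub finite_interval] by simp
    with D obtain y where y: "y \<in> ?D" "\<And>c. c \<in> ?D \<Longrightarrow> (y, c) \<in> r" using chain_least by blast
    have ay: "(a, y) \<in> r" "a \<noteq> y" "(y, b) \<in> r" using y C_sub by (auto simp: interval_iff)
    have "covers a y"
      unfolding covers_def
    proof (intro conjI allI impI, rule ay(1), rule ay(2))
      fix c assume c: "(a, c) \<in> r \<and> (c, y) \<in> r"
      have "c \<in> C"
      proof (rule add)
        show "c \<in> interval a b" using c ay(3) trans_r[of c y b] by (simp add: interval_iff)
        show "(d, c) \<in> r \<or> (c, d) \<in> r" if "d \<in> C" for d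
          using c y(2)[of d] that trans_r[of c y d] by (cases "d = a") blast+
      qed
      then show "c = a \<or> c = y" using y(2) c antisym_r by blast
    qed
    moreover have "maximal_chain_in r (interval y b) ?D"
      unfolding maximal_chain_in_def
    proof (intro conjI ballI)
      show "?D \<subseteq> interval y b" using y(2) C_sub unfolding subset_iff interval_iff by blast
      show "is_chain r ?D" by fact
      fix e assume e: "e \<in> interval y b - ?D"
      then have ae: "(a, e) \<in> r" using ay(1) trans_r[of a y e] by (simp add: interval_iff)
      have "e \<noteq> a" using e ay antisym_r[of a y] by (auto simp: interval_iff)
      have "e \<notin> C" using e \<open>e \<noteq> a\<close> by auto
      show "\<not> is_chain r (insert e ?D)"
      proof
        assume "is_chain r (insert e ?D)"
        then have "\<And>c. c \<in> ?D \<Longrightarrow> (c, e) \<in> r \<or> (e, c) \<in> r"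
          unfolding is_chain_iff by blast
        then have "\<And>c. c \<in> C \<Longrightarrow> (c, e) \<in> r \<or> (e, c) \<in> r" using ae by blast
        then have "e \<in> C" using add[of e] e ae by (simp add: interval_iff)
        with \<open>e \<notin> C\<close> show False ..
      qed
    qed
    ultimately obtain xs where xs: "path a (y # xs) b" "?D = set (y # xs)"
      using less.hyps[OF interval_shrinks[OF ay] ay(3), of ?D] by auto
    then have "C = set (a # y # xs)" using a by auto
    then show ?thesis using xs(1) by blast
  qed
qed

lemma EL_labeling: "EL_labeling M r f"
  unfolding EL_labeling_def Let_def
proof (intro ballI impI)
  fix a b assume a: "a \<in> M" and "b \<in> M" and ab: "(a, b) \<in> r \<and> a \<noteq> b"
  obtain xs where xs: "path a xs b" "sorted_wrt (<) (labels a xs)"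
    and others: "\<And>ys. path a ys b \<Longrightarrow> ys \<noteq> xs \<Longrightarrow>
      \<not> sorted_wrt (<) (labels a ys) \<and> (labels a xs, labels a ys) \<in> lex less_than"
    using least_label_path ab by blast
  let ?C = "set (a # xs)"
  have C: "maximal_chain_in r (interval a b) ?C" "increasing_chain r f ?C"
    using path_maximal_chain[OF a xs(1)] xs label_vector_path[OF a xs(1)]
    by (simp_all add: increasing_chain_def)
  have D: "\<not> increasing_chain r f D \<and> (label_vector r f ?C, label_vector r f D) \<in> lex less_than"
    if D: "maximal_chain_in r (interval a b) D" "D \<noteq> ?C" for D
  proof -
    obtain ys where ys: "path a ys b" "D = set (a # ys)" using maximal_chain_path D(1) ab by blast
    then have "ys \<noteq> xs" using D(2) by blast
    then show ?thesis
      using others[OF ys(1)] label_vector_path[OF a xs(1)] label_vector_path[OF a ys(1)] ys(2)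
      by (simp add: increasing_chain_def)
  qed
  show "(\<exists>!C. maximal_chain_in r (interval a b) C \<and> increasing_chain r f C) \<and>
    (\<forall>C D. maximal_chain_in r (interval a b) C \<and> increasing_chain r f C \<and>
      maximal_chain_in r (interval a b) D \<and> D \<noteq> C \<longrightarrow>
      (label_vector r f C, label_vector r f D) \<in> lex less_than)"
    using C D by blast
qed

text \<open>A bounded poset is one interval, so its maximal chains are paths whose length is a difference of
  ranks.\<close>

lemma graded:
  assumes "bounded_poset M r"
  shows "graded_poset M r"
proof -
  obtain bot top where bt: "bot \<in> M" "top \<in> M" "\<And>a. a \<in> M \<Longrightarrow> (bot, a) \<in> r \<and> (a, top) \<in> r"
    using assms unfolding bounded_poset_def by blast
  then have M: "M = interval bot top" by (auto simp: poset_interval_def)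
  have "int (card C) = rk top - rk bot + 1" if C: "maximal_chain_in r M C" for C
  proof -
    obtain xs where xs: "path bot xs top" "C = set (bot # xs)"
      using maximal_chain_path[of bot top C] C M bt by auto
    have "\<And>ys. sorted_wrt (\<lambda>c d. (c, d) \<in> r \<and> c \<noteq> d) ys \<Longrightarrow> distinct ys"
      subgoal for ys by (induction ys) auto
      done
    then have "distinct (bot # xs)" using path_sorted[OF bt(1) xs(1)] by blast
    then show ?thesis using xs path_length[OF xs(1)] distinct_card[of "bot # xs"] by simp
  qed
  then show ?thesis unfolding graded_poset_def chain_length_def by (metis of_nat_eq_iff)
qed

theorem EL_shellable: "bounded_poset M r \<Longrightarrow> EL_shellable M r"
  unfolding EL_shellable_def using finite_carrier po graded EL_labeling by blast

end

section \<open>The order on partition-like systems\<close>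

definition hybrids :: "'a set_pair set \<Rightarrow> 'a set set" where
  "hybrids a = snd ` a - {{}}"

lemma hybrids_iff: "H \<in> hybrids a \<longleftrightarrow> H \<noteq> {} \<and> (\<exists>S. (S, H) \<in> a)"
proof -
  have "H \<in> snd ` a \<longleftrightarrow> (\<exists>S. (S, H) \<in> a)" by (auto intro: rev_image_eqI)
  then show ?thesis by (auto simp: hybrids_def)
qed

text \<open>The conditions in terms of membership of pairs: a block determines its second component, and every
  hybrid has exactly two sides. The latter replaces the existence of a unique partner for each side.\<close>

lemma partition_like_iff:
  "partition_like X a \<longleftrightarrow>
    (\<forall>S H. (S, H) \<in> a \<longrightarrow> S \<subseteq> X \<and> H \<subseteq> X \<and> S \<noteq> {} \<and> S \<inter> H = {}) \<and>
    (\<forall>S H T K. (S, H) \<in> a \<and> (T, K) \<in> a \<and> S \<inter> T \<noteq> {} \<longrightarrow> S = T \<and> H = K) \<and>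
    (\<forall>z\<in>X. \<exists>S H. (S, H) \<in> a \<and> z \<in> S) \<and>
    (\<forall>H\<in>hybrids a. (H, {}) \<in> a \<and>
      (\<exists>S T. S \<noteq> T \<and> (\<forall>U. (U, H) \<in> a \<longleftrightarrow> U = S \<or> U = T)))"
  (is "_ \<longleftrightarrow> ?sub \<and> ?disj \<and> ?cover \<and> ?hyb")
proof
  assume pl: "partition_like X a"
  note parts = pl[unfolded partition_like_def]
  note sps = parts[THEN conjunct1] and po = parts[THEN conjunct2, THEN conjunct1]
    and inj = parts[THEN conjunct2, THEN conjunct2, THEN conjunct1]
    and hyb = parts[THEN conjunct2, THEN conjunct2, THEN conjunct2]
  have sub: ?sub
    using bspec[OF sps[unfolded set_pair_system_def], of "(S, H)" for S H] by simp
  have disj: ?disj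
  proof (intro allI impI)
    fix S H T K assume st: "(S, H) \<in> a \<and> (T, K) \<in> a \<and> S \<inter> T \<noteq> {}"
    then have "S \<in> fst ` a" "T \<in> fst ` a" by (auto intro: rev_image_eqI)
    then have "S = T"
      using partition_onD2[OF po] st unfolding disjoint_def by blast
    then show "S = T \<and> H = K" using inj st by auto
  qed
  have cover: ?cover
  proof
    fix z assume "z \<in> X"
    then have "z \<in> \<Union> (fst ` a)" using partition_onD1[OF po] by simp
    then show "\<exists>S H. (S, H) \<in> a \<and> z \<in> S" by auto
  qed
  have ?hyb
  proof
    fix H assume "H \<in> hybrids a"
    then obtain S where S: "(S, H) \<in> a" "H \<noteq> {}" by (auto simp: hybrids_iff)
    have H: "(H, {}) \<in> a" and ex: "\<exists>!q. q \<in> a \<and> q \<noteq> (S, H) \<and> snd q = H"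
      using bspec[OF hyb S(1)] S(2) by simp_all
    obtain q where q: "q \<in> a \<and> q \<noteq> (S, H) \<and> snd q = H"
      and uniq: "\<forall>q'. q' \<in> a \<and> q' \<noteq> (S, H) \<and> snd q' = H \<longrightarrow> q' = q"
      by (rule ex1E[OF ex], rule that)
    from q obtain T where T: "(T, H) \<in> a" "T \<noteq> S" by (cases q) auto
    have "U = T" if "(U, H) \<in> a" "U \<noteq> S" for U
      using uniq[rule_format, of "(U, H)"] uniq[rule_format, of "(T, H)"] T that by simp
    then have "\<forall>U. (U, H) \<in> a \<longleftrightarrow> U = S \<or> U = T" using T(1) S(1) by blast
    then show "(H, {}) \<in> a \<and> (\<exists>S T. S \<noteq> T \<and> (\<forall>U. (U, H) \<in> a \<longleftrightarrow> U = S \<or> U = T))"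
      using H T(2) by blast
  qed
  with sub disj cover show "?sub \<and> ?disj \<and> ?cover \<and> ?hyb" by (intro conjI)
next
  assume conds: "?sub \<and> ?disj \<and> ?cover \<and> ?hyb"
  note sub = conds[THEN conjunct1] and disj = conds[THEN conjunct2, THEN conjunct1]
    and cover = conds[THEN conjunct2, THEN conjunct2, THEN conjunct1]
    and hyb = conds[THEN conjunct2, THEN conjunct2, THEN conjunct2]
  show "partition_like X a"
    unfolding partition_like_def
  proof (intro conjI)
    show "set_pair_system X a"
      unfolding set_pair_system_def
    proof clarify
      fix S H assume "(S, H) \<in> a"
      then show "S \<subseteq> X \<and> H \<subseteq> X \<and> S \<noteq> {} \<and> S \<inter> H = {}" using sub by simp
    qed
    show "partition_on X (fst ` a)"
    proof (rule partition_onI)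
      show "\<Union> (fst ` a) = X"
      proof
        show "\<Union> (fst ` a) \<subseteq> X"
        proof (intro Union_least)
          fix p assume "p \<in> fst ` a"
          then obtain H where "(p, H) \<in> a" by auto
          then show "p \<subseteq> X" using sub by simp
        qed
        show "X \<subseteq> \<Union> (fst ` a)"
        proof
          fix z assume "z \<in> X"
          then obtain S H where "(S, H) \<in> a" "z \<in> S" using cover by blast
          then show "z \<in> \<Union> (fst ` a)" by force
        qed
      qed
      fix p p' assume p: "p \<in> fst ` a" "p' \<in> fst ` a" and ne: "p \<noteq> p'"
      from p obtain H H' where "(p, H) \<in> a" "(p', H') \<in> a" by auto
      then show "disjnt p p'" using disj ne unfolding disjnt_def by blast
    next
      show "{} \<notin> fst ` a" using sub by force
    qed
    have "H = K" if "(S, H) \<in> a" "(S, K) \<in> a" for S H K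
    proof -
      have "S \<inter> S \<noteq> {}" using sub that(1) by simp
      then show ?thesis using disj that by blast
    qed
    then show "\<forall>(S, H)\<in>a. \<forall>(S', H')\<in>a. (S, H) \<noteq> (S', H') \<longrightarrow> S \<noteq> S'" by auto
    have "(H, {}) \<in> a \<and> (\<exists>!q. q \<in> a \<and> q \<noteq> (S, H) \<and> snd q = H)"
      if S: "(S, H) \<in> a" "H \<noteq> {}" for S H
    proof -
      have H: "H \<in> hybrids a" using S by (auto simp: hybrids_iff)
      obtain T U where TU: "T \<noteq> U" "\<And>V. (V, H) \<in> a \<longleftrightarrow> V = T \<or> V = U"
        using bspec[OF hyb H] by metis
      define V where "V = (if S = T then U else T)"
      then have V: "V \<noteq> S" "(V, H) \<in> a" using TU by auto
      have "\<exists>!q. q \<in> a \<and> q \<noteq> (S, H) \<and> snd q = H"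
      proof (rule ex1I[of _ "(V, H)"])
        show "(V, H) \<in> a \<and> (V, H) \<noteq> (S, H) \<and> snd (V, H) = H" using V by simp
        fix q assume q: "q \<in> a \<and> q \<noteq> (S, H) \<and> snd q = H"
        then have "(fst q, H) \<in> a" "fst q \<noteq> S" by (cases q, auto)+
        then have "fst q = V" using TU S(1) by (metis V_def)
        then show "q = (V, H)" using q by (cases q) simp
      qed
      then show ?thesis using H hyb by blast
    qed
    then show "\<forall>(S, H)\<in>a. H \<noteq> {} \<longrightarrow> (H, {}) \<in> a \<and> (\<exists>!q. q \<in> a \<and> q \<noteq> (S, H) \<and> snd q = H)"
      by blast
  qed
qed

context
  fixes X :: "'a set" and a :: "'a set_pair set"
  assumes pl: "partition_like X a"
begin

lemma pair_sub:
  assumes "(S, H) \<in> a"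
  shows "S \<subseteq> X" "H \<subseteq> X" "S \<noteq> {}" "S \<inter> H = {}"
  using pl assms unfolding partition_like_iff by simp_all

lemma same_block: "(S, H) \<in> a \<Longrightarrow> (T, K) \<in> a \<Longrightarrow> z \<in> S \<Longrightarrow> z \<in> T \<Longrightarrow> S = T \<and> H = K"
  using pl[unfolded partition_like_iff, THEN conjunct2, THEN conjunct1] by blast

lemma meeting_blocks: "(S, H) \<in> a \<Longrightarrow> (T, K) \<in> a \<Longrightarrow> S \<inter> T \<noteq> {} \<Longrightarrow> S = T \<and> H = K"
  using same_block by blast

lemma unique_hybrid: "(S, H) \<in> a \<Longrightarrow> (S, K) \<in> a \<Longrightarrow> H = K"
  using pair_sub(3) same_block by blast

lemma block_of: "z \<in> X \<Longrightarrow> \<exists>S H. (S, H) \<in> a \<and> z \<in> S"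
  using pl unfolding partition_like_iff by blast

lemma hybrid_block: "H \<in> hybrids a \<Longrightarrow> (H, {}) \<in> a"
  using pl unfolding partition_like_iff by blast

lemma hybrid_sides: "H \<in> hybrids a \<Longrightarrow> \<exists>S T. S \<noteq> T \<and> (\<forall>U. (U, H) \<in> a \<longleftrightarrow> U = S \<or> U = T)"
  using pl unfolding partition_like_iff by blast

lemma other_side:
  assumes "(S, H) \<in> a" "H \<noteq> {}"
  shows "\<exists>T. T \<noteq> S \<and> (\<forall>U. (U, H) \<in> a \<longleftrightarrow> U = S \<or> U = T)"
proof -
  have "H \<in> hybrids a" using assms unfolding hybrids_iff by blast
  then obtain P Q where PQ: "P \<noteq> Q" "\<forall>U. (U, H) \<in> a \<longleftrightarrow> U = P \<or> U = Q"
    using hybrid_sides by meson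
  then have "S = P \<or> S = Q" using assms(1) by blast
  then show ?thesis using PQ by (elim disjE) (intro exI[of _ Q] exI[of _ P], simp, blast)+
qed

lemma side_not_hybrid: "(S, H) \<in> a \<Longrightarrow> H \<noteq> {} \<Longrightarrow> S \<notin> hybrids a"
  using hybrid_block unique_hybrid by blast

lemma finite_system: "finite X \<Longrightarrow> finite a"
  using pair_sub(1,2) by (intro finite_subset[of a "Pow X \<times> Pow X"]) fastforce+

lemma hybrids_disjoint: "H \<in> hybrids a \<Longrightarrow> K \<in> hybrids a \<Longrightarrow> z \<in> H \<Longrightarrow> z \<in> K \<Longrightarrow> H = K"
  using hybrid_block same_block by blast

end

text \<open>The distinction between equal and different pairs disappears because the components of a pair in a
  system are disjoint and the first one is nonempty.\<close>

lemma set_pair_le_iff: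
  assumes "S \<inter> H = {}" "S \<noteq> {}"
  shows "set_pair_le (S, H) (T, K) \<longleftrightarrow> S \<subseteq> T \<and> (H \<subseteq> T \<or> H = K)"
  using assms by auto

lemma system_le_iff:
  assumes "partition_like X a"
  shows "system_le a b \<longleftrightarrow>
    (\<forall>S H. (S, H) \<in> a \<longrightarrow> (\<exists>T K. (T, K) \<in> b \<and> S \<subseteq> T \<and> (H \<subseteq> T \<or> H = K))) \<and>
    (\<forall>T K. (T, K) \<in> b \<and> K \<in> hybrids a \<longrightarrow> (\<exists>S. (S, K) \<in> a \<and> S \<subseteq> T))"
proof -
  have le: "set_pair_le (S, H) (T, K) \<longleftrightarrow> S \<subseteq> T \<and> (H \<subseteq> T \<or> H = K)" if "(S, H) \<in> a" for S H T K
    using pair_sub[OF assms that] set_pair_le_iff by blast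
  have sp1: "(\<forall>p\<in>a. \<exists>q\<in>b. set_pair_le p q) \<longleftrightarrow>
    (\<forall>S H. (S, H) \<in> a \<longrightarrow> (\<exists>T K. (T, K) \<in> b \<and> S \<subseteq> T \<and> (H \<subseteq> T \<or> H = K)))"
    by (simp add: Ball_def Bex_def le del: set_pair_le.simps cong: imp_cong)
  have sp2: "(\<forall>q\<in>b. snd q \<noteq> {} \<longrightarrow> (\<exists>p\<in>a. snd p = snd q) \<longrightarrow>
      (\<exists>p\<in>a. snd p = snd q \<and> set_pair_le p q)) \<longleftrightarrow>
    (\<forall>T K. (T, K) \<in> b \<and> K \<in> hybrids a \<longrightarrow> (\<exists>S. (S, K) \<in> a \<and> S \<subseteq> T))"
    by (auto simp: Ball_def Bex_def hybrids_iff le simp del: set_pair_le.simps cong: conj_cong)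
  show ?thesis unfolding system_le_def sp1 sp2 ..
qed

context
  fixes X :: "'a set" and a b :: "'a set_pair set"
  assumes pa: "partition_like X a" and pb: "partition_like X b" and le: "system_le a b"
begin

lemma le_pair: "(S, H) \<in> a \<Longrightarrow> \<exists>T K. (T, K) \<in> b \<and> S \<subseteq> T \<and> (H \<subseteq> T \<or> H = K)"
  using le unfolding system_le_iff[OF pa] by blast

lemma le_side: "(T, K) \<in> b \<Longrightarrow> K \<in> hybrids a \<Longrightarrow> \<exists>S. (S, K) \<in> a \<and> S \<subseteq> T"
  using le unfolding system_le_iff[OF pa] by blast

lemma le_block:
  assumes "(S, H) \<in> a" "(T, K) \<in> b" "z \<in> S" "z \<in> T"
  shows "S \<subseteq> T"
proof -
  obtain U L where "(U, L) \<in> b" "S \<subseteq> U" using le_pair assms(1) by blast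
  then show ?thesis using same_block[OF pb, of U L T K z] assms by blast
qed

text \<open>If \<open>H\<close> is also a hybrid of \<open>b\<close>, then it is a block of \<open>b\<close>, so no other block of \<open>b\<close> can absorb it:
  the side stays a side.\<close>

lemma kept_side:
  assumes "(S, H) \<in> a" "H \<in> hybrids b"
  shows "\<exists>T. (T, H) \<in> b \<and> S \<subseteq> T"
proof -
  obtain T K where T: "(T, K) \<in> b" "S \<subseteq> T" "H \<subseteq> T \<or> H = K" using le_pair assms(1) by blast
  have "H \<noteq> {}" "(H, {}) \<in> b" using assms(2) hybrid_block[OF pb] by (auto simp: hybrids_iff)
  have "\<not> H \<subseteq> T"
  proof
    assume "H \<subseteq> T"
    then have "T = H" using same_block[OF pb T(1) \<open>(H, {}) \<in> b\<close>] \<open>H \<noteq> {}\<close> by blast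
    then show False using T(2) pair_sub[OF pa assms(1)] by blast
  qed
  then show ?thesis using T by blast
qed

lemma lost_side:
  assumes "(S, H) \<in> a" "H \<notin> hybrids b"
  shows "\<exists>T K. (T, K) \<in> b \<and> S \<union> H \<subseteq> T"
proof -
  obtain T K where T: "(T, K) \<in> b" "S \<subseteq> T" "H \<subseteq> T \<or> H = K" using le_pair assms(1) by blast
  then have "H \<subseteq> T" using assms(2) by (auto simp: hybrids_iff)
  then show ?thesis using T by blast
qed

end

lemma system_le_refl: "partition_like X a \<Longrightarrow> system_le a a"
  unfolding system_le_iff by blast

text \<open>A lost hybrid is absorbed, together with a side, by a block of \<open>b\<close>, and hence by a block of \<open>c\<close>;
  so it is no longer a block of its own.\<close>

lemma lost_stays_lost:
  assumes "partition_like X a" "partition_like X b" "partition_like X c"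
    and "system_le a b" "system_le b c" "H \<in> hybrids a" "H \<notin> hybrids b"
  shows "H \<notin> hybrids c"
proof
  assume "H \<in> hybrids c"
  then have Hc: "(H, {}) \<in> c" using hybrid_block assms(3) by blast
  obtain S where S: "(S, H) \<in> a" "H \<noteq> {}" using assms(6) by (auto simp: hybrids_iff)
  obtain T K where T: "(T, K) \<in> b" "S \<union> H \<subseteq> T"
    using lost_side[OF assms(1,2,4) S(1) assms(7)] by blast
  obtain U L where U: "(U, L) \<in> c" "T \<subseteq> U" using le_pair[OF assms(2,3,5) T(1)] by blast
  have "U = H" using same_block[OF assms(3) U(1) Hc] U(2) T(2) S(2) by blast
  then show False using U(2) T(2) pair_sub[OF assms(1) S(1)] by blast
qed

text \<open>For (SP2), a hybrid common to \<open>a\<close> and \<open>c\<close> is one of \<open>b\<close> too, since lost hybrids stay lost. Its sides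
  can then be traced back through \<open>b\<close>.\<close>

lemma system_le_trans:
  assumes "partition_like X a" "partition_like X b" "partition_like X c"
    and ab: "system_le a b" and bc: "system_le b c"
  shows "system_le a c"
  unfolding system_le_iff[OF assms(1)]
proof (intro conjI allI impI)
  fix S H assume "(S, H) \<in> a"
  then obtain T K where T: "(T, K) \<in> b" "S \<subseteq> T" "H \<subseteq> T \<or> H = K"
    using le_pair[OF assms(1,2) ab] by blast
  then obtain U L where U: "(U, L) \<in> c" "T \<subseteq> U" "K \<subseteq> U \<or> K = L"
    using le_pair[OF assms(2,3) bc] by blast
  then show "\<exists>U L. (U, L) \<in> c \<and> S \<subseteq> U \<and> (H \<subseteq> U \<or> H = L)"
    using T by (intro exI[of _ U] exI[of _ L]) blast
next
  fix U L assume U: "(U, L) \<in> c \<and> L \<in> hybrids a"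
  then have "L \<in> hybrids c" by (auto simp: hybrids_iff)
  then have "L \<in> hybrids b" using lost_stays_lost[OF assms] U by blast
  then obtain T where "(T, L) \<in> b" "T \<subseteq> U" using le_side[OF assms(2,3) bc] U by blast
  then show "\<exists>S. (S, L) \<in> a \<and> S \<subseteq> U" using le_side[OF assms(1,2) ab] U by blast
qed

text \<open>Antisymmetry, in one direction: the two partitions refine each other, hence agree, and a block cannot
  contain its own nonempty second component.\<close>

lemma system_le_subset:
  assumes "partition_like X a" "partition_like X b" "system_le a b" "system_le b a"
  shows "a \<subseteq> b"
proof clarify
  fix S H assume S: "(S, H) \<in> a"
  obtain T K where T: "(T, K) \<in> b" "S \<subseteq> T" "H \<subseteq> T \<or> H = K"
    using le_pair[OF assms(1-3) S] by blast
  obtain S' H' where S': "(S', H') \<in> a" "T \<subseteq> S'" "K \<subseteq> S' \<or> K = H'"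
    using le_pair[OF assms(2,1,4) T(1)] by blast
  have "S' = S \<and> H' = H"
    using same_block[OF assms(1) S' (1) S] pair_sub(3)[OF assms(1) S] S'(2) T(2) by blast
  then have "T = S" using S' T by blast
  then have "H = {} \<or> H = K" "K = {} \<or> K = H"
    using T(3) S'(3) \<open>S' = S \<and> H' = H\<close> pair_sub(4)[OF assms(1) S] pair_sub(4)[OF assms(2) T(1)]
    by blast+
  then show "(S, H) \<in> b" using T(1) \<open>T = S\<close> by auto
qed

lemma ranked_cactus_order_iff:
  "(a, b) \<in> ranked_cactus_order X \<longleftrightarrow> partition_like X a \<and> partition_like X b \<and> system_le a b"
  by (simp add: ranked_cactus_order_def relation_of_def partition_like_systems_def)

lemma partial_order_ranked_cactus:
  "partial_order_on (partition_like_systems X) (ranked_cactus_order X)"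
  unfolding partial_order_on_def preorder_on_def
proof (intro conjI)
  show "ranked_cactus_order X \<subseteq> partition_like_systems X \<times> partition_like_systems X"
    by (auto simp: ranked_cactus_order_iff partition_like_systems_def)
  show "refl_on (partition_like_systems X) (ranked_cactus_order X)"
    by (auto simp: refl_on_def ranked_cactus_order_iff partition_like_systems_def system_le_refl)
  show "trans (ranked_cactus_order X)"
    unfolding trans_def ranked_cactus_order_iff using system_le_trans by blast
  show "antisym (ranked_cactus_order X)"
    unfolding antisym_def ranked_cactus_order_iff using system_le_subset by blast
qed

lemma finite_partition_like_systems: "finite X \<Longrightarrow> finite (partition_like_systems X)"
proof (rule finite_subset)
  show "partition_like_systems X \<subseteq> Pow (Pow X \<times> Pow X)"
    using pair_sub(1,2) by (fastforce simp: partition_like_systems_def)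
qed simp

lemma bounded_ranked_cactus:
  assumes "X \<noteq> {}"
  shows "bounded_poset (partition_like_systems X) (ranked_cactus_order X)"
proof -
  let ?bot = "(\<lambda>x. ({x}, {})) ` X" and ?top = "{(X, {})}"
  have hyb: "hybrids ?bot = {}" "hybrids ?top = {}" by (auto simp: hybrids_iff)
  have pl: "partition_like X ?bot" "partition_like X ?top"
    using assms by (auto simp: partition_like_iff hyb)
  have "system_le ?bot a \<and> system_le a ?top" if a: "partition_like X a" for a
  proof
    show "system_le ?bot a"
      unfolding system_le_iff[OF pl(1)] hyb using block_of[OF a] by auto
    show "system_le a ?top"
      unfolding system_le_iff[OF a] using pair_sub(1,2)[OF a] by (auto simp: hybrids_iff)
  qed
  then show ?thesis
    unfolding bounded_poset_def ranked_cactus_order_iff partition_like_systems_def mem_Collect_eq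
    using pl by blast
qed

section \<open>The three elementary moves\<close>

text \<open>The triple with hybrid \<open>H\<close> consists of the pairs whose first or second component is \<open>H\<close>.\<close>

definition collapse :: "'a set_pair set \<Rightarrow> 'a set \<Rightarrow> 'a set_pair set" where
  "collapse a H = insert (H \<union> \<Union>{S. (S, H) \<in> a}, {}) {p \<in> a. snd p \<noteq> H \<and> fst p \<noteq> H}"

text \<open>Only \<open>A\<close> may be a side; its hybrid \<open>K\<close> (or \<open>{}\<close>) is inherited by the union.\<close>

definition merge :: "'a set_pair set \<Rightarrow> 'a set \<Rightarrow> 'a set \<Rightarrow> 'a set \<Rightarrow> 'a set_pair set" where
  "merge a A K B = insert (A \<union> B, K) (a - {(A, K), (B, {})})"

definition spawn :: "'a set_pair set \<Rightarrow> 'a set \<Rightarrow> 'a set \<Rightarrow> 'a set \<Rightarrow> 'a set_pair set" where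
  "spawn a S T H = insert (S, H) (insert (T, H) (a - {(S, {}), (T, {})}))"

text \<open>The number of triples minus the number of blocks: a collapse removes one triple and two blocks, a merge
  one block, and a spawned triple adds one triple without changing the blocks.\<close>

definition cactus_rank :: "'a set_pair set \<Rightarrow> int" where
  "cactus_rank a = int (card (hybrids a)) - int (card a)"

text \<open>Replacing some blocks by one new block \<open>W\<close> keeps the blocks disjoint if \<open>W\<close> misses all others.\<close>

lemma meet_replaced:
  assumes "partition_like X a" and x: "\<And>U L. (U, L) \<in> x \<Longrightarrow> U = W \<and> L = N \<or> (U, L) \<in> a \<and> U \<inter> W = {}"
    and "(U, L) \<in> x" "(V, M) \<in> x" "U \<inter> V \<noteq> {}"
  shows "U = V \<and> L = M"
  using x[OF assms(3)] x[OF assms(4)]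
proof (elim disjE conjE)
  assume "(U, L) \<in> a" "(V, M) \<in> a"
  then show ?thesis using meeting_blocks[OF assms(1)] assms(5) by blast
qed (use assms(5) in auto)

lemma finite_hybrids: "finite a \<Longrightarrow> finite (hybrids a)"
  by (simp add: hybrids_def)

context
  fixes X :: "'a set" and a :: "'a set_pair set" and H S T :: "'a set"
  assumes pa: "partition_like X a" and H: "H \<in> hybrids a"
    and ST: "S \<noteq> T" "\<And>U. (U, H) \<in> a \<longleftrightarrow> U = S \<or> U = T"
begin

lemma triple_pairs: "(S, H) \<in> a" "(T, H) \<in> a" "(H, {}) \<in> a" "H \<noteq> {}"
  using ST(2) H hybrid_block[OF pa H] by (auto simp: hybrids_iff)

lemma sides_union: "\<Union>{U. (U, H) \<in> a} = S \<union> T"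
  by (auto simp: ST(2))

lemma collapse_pair_iff:
  "(U, L) \<in> collapse a H \<longleftrightarrow>
    U = H \<union> S \<union> T \<and> L = {} \<or> (U, L) \<in> a \<and> L \<noteq> H \<and> U \<noteq> H"
  by (simp add: collapse_def sides_union Un_assoc)

lemma collapse_disjoint:
  assumes "(U, L) \<in> a" "L \<noteq> H" "U \<noteq> H"
  shows "U \<inter> (H \<union> S \<union> T) = {}"
  using same_block[OF pa assms(1) triple_pairs(1)] same_block[OF pa assms(1) triple_pairs(2)]
    same_block[OF pa assms(1) triple_pairs(3)] assms(2,3) by blast

lemma hybrids_collapse: "hybrids (collapse a H) = hybrids a - {H}"
proof -
  have "U \<noteq> H" if "(U, K) \<in> a" "K \<noteq> {}" for U K
    using that unique_hybrid[OF pa] triple_pairs(3) by blast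
  then show ?thesis by (auto simp: hybrids_iff collapse_pair_iff)
qed

lemma partition_like_collapse: "partition_like X (collapse a H)"
  unfolding partition_like_iff
proof (intro conjI allI impI ballI)
  fix U L assume U: "(U, L) \<in> collapse a H"
  have W: "H \<union> S \<union> T \<subseteq> X" using pair_sub(1)[OF pa] triple_pairs(1-3) by blast
  have "U \<subseteq> X \<and> L \<subseteq> X \<and> U \<noteq> {} \<and> U \<inter> L = {}"
    using U unfolding collapse_pair_iff
  proof (elim disjE conjE)
    assume "(U, L) \<in> a"
    then show ?thesis using pair_sub[OF pa] by simp
  qed (use W triple_pairs(4) in simp)
  then show "U \<subseteq> X" "L \<subseteq> X" "U \<noteq> {}" "U \<inter> L = {}" by simp_all
next
  fix U L V M assume "(U, L) \<in> collapse a H \<and> (V, M) \<in> collapse a H \<and> U \<inter> V \<noteq> {}"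
  note meet = this
  have repl: "U = H \<union> S \<union> T \<and> L = {} \<or> (U, L) \<in> a \<and> U \<inter> (H \<union> S \<union> T) = {}"
    if "(U, L) \<in> collapse a H" for U L
    using that unfolding collapse_pair_iff
    by (elim disjE conjE) (simp, intro disjI2 conjI collapse_disjoint)
  have "U = V \<and> L = M"
    by (rule meet_replaced[OF pa, of "collapse a H" "H \<union> S \<union> T" "{}"]) (use repl meet in simp_all)
  then show "U = V" "L = M" by simp_all
next
  fix z assume "z \<in> X"
  then obtain U L where U: "(U, L) \<in> a" "z \<in> U" using block_of[OF pa] by blast
  show "\<exists>U L. (U, L) \<in> collapse a H \<and> z \<in> U"
  proof (cases "L = H \<or> U = H")
    case True
    then have "z \<in> H \<union> S \<union> T" using U ST(2) by blast
    then show ?thesis using collapse_pair_iff by blast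
  next
    case False
    then show ?thesis using U collapse_pair_iff by blast
  qed
next
  fix K assume "K \<in> hybrids (collapse a H)"
  then have K: "K \<in> hybrids a" "K \<noteq> H" using hybrids_collapse by auto
  then have "K \<noteq> {}" by (simp add: hybrids_iff)
  show "(K, {}) \<in> collapse a H"
    using K hybrid_block[OF pa] triple_pairs(4) unfolding collapse_pair_iff by blast
  have "(U, K) \<in> collapse a H \<longleftrightarrow> (U, K) \<in> a" for U
    using K(2) \<open>K \<noteq> {}\<close> unique_hybrid[OF pa, of H K "{}"] triple_pairs(3)
    unfolding collapse_pair_iff by blast
  then show "\<exists>S T. S \<noteq> T \<and> (\<forall>U. (U, K) \<in> collapse a H \<longleftrightarrow> U = S \<or> U = T)"
    using hybrid_sides[OF pa K(1)] by simp
qed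

lemma le_collapse: "system_le a (collapse a H)"
  unfolding system_le_iff[OF pa]
proof (intro conjI allI impI)
  fix U L assume U: "(U, L) \<in> a"
  show "\<exists>T K. (T, K) \<in> collapse a H \<and> U \<subseteq> T \<and> (L \<subseteq> T \<or> L = K)"
  proof (cases "L = H \<or> U = H")
    case True
    then have "U \<union> L \<subseteq> H \<union> S \<union> T" using U ST(2) unique_hybrid[OF pa U, of "{}"] triple_pairs(3) by blast
    then show ?thesis by (intro exI[of _ "H \<union> S \<union> T"] exI[of _ "{}"]) (auto simp: collapse_pair_iff)
  next
    case False
    then show ?thesis using U collapse_pair_iff by blast
  qed
next
  fix U L assume "(U, L) \<in> collapse a H \<and> L \<in> hybrids a"
  then show "\<exists>S. (S, L) \<in> a \<and> S \<subseteq> U" unfolding collapse_pair_iff hybrids_iff by blast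
qed

text \<open>Collapsing is the least way to lose \<open>H\<close>: both sides are absorbed together with \<open>H\<close>, and since \<open>H\<close> is
  nonempty, by the same block.\<close>

lemma collapse_le:
  assumes pb: "partition_like X b" and le: "system_le a b" and "H \<notin> hybrids b"
  shows "system_le (collapse a H) b"
  unfolding system_le_iff[OF partition_like_collapse]
proof (intro conjI allI impI)
  fix U L assume "(U, L) \<in> collapse a H"
  then consider "U = H \<union> S \<union> T" "L = {}" | "(U, L) \<in> a" unfolding collapse_pair_iff by blast
  then show "\<exists>V K. (V, K) \<in> b \<and> U \<subseteq> V \<and> (L \<subseteq> V \<or> L = K)"
  proof cases
    case 1
    obtain V K V' K' where V: "(V, K) \<in> b" "S \<union> H \<subseteq> V" "(V', K') \<in> b" "T \<union> H \<subseteq> V'"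
      using lost_side[OF pa pb le _ assms(3)] triple_pairs(1,2) by meson
    then have "V = V'" using same_block[OF pb V(1,3)] triple_pairs(4) by blast
    then show ?thesis using V 1 by blast
  next
    case 2
    then show ?thesis using le_pair[OF pa pb le] by blast
  qed
next
  fix V K assume V: "(V, K) \<in> b \<and> K \<in> hybrids (collapse a H)"
  then have K: "K \<in> hybrids a" "K \<noteq> H" "K \<noteq> {}" by (auto simp: hybrids_collapse hybrids_iff)
  then obtain U where U: "(U, K) \<in> a" "U \<subseteq> V" using le_side[OF pa pb le] V by blast
  then have "U \<noteq> H" using unique_hybrid[OF pa U(1), of "{}"] triple_pairs(3) K(3) by blast
  then show "\<exists>U. (U, K) \<in> collapse a H \<and> U \<subseteq> V" using U K(2) collapse_pair_iff by blast
qed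

lemma cactus_rank_collapse:
  assumes "finite X"
  shows "cactus_rank (collapse a H) = cactus_rank a + 1"
proof -
  have fin: "finite a" using finite_system[OF pa assms] .
  let ?rest = "{p \<in> a. snd p \<noteq> H \<and> fst p \<noteq> H}" and ?W = "H \<union> S \<union> T"
  have ne: "S \<noteq> H" "T \<noteq> H" using pair_sub(3,4)[OF pa triple_pairs(1)] pair_sub(3,4)[OF pa triple_pairs(2)] by auto
  let ?F = "{(H, {}), (S, H), (T, H)}"
  have mem: "L = H \<or> U = H \<longleftrightarrow> (U, L) \<in> ?F" if "(U, L) \<in> a" for U L
  proof (cases "L = H")
    case True
    then show ?thesis using that ST(2)[of U] by simp
  next
    case False
    then show ?thesis using that unique_hybrid[OF pa, of H L "{}"] triple_pairs(3) by auto
  qed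
  have "?rest = a - ?F"
  proof (rule set_eqI)
    fix p
    show "p \<in> ?rest \<longleftrightarrow> p \<in> a - ?F" using mem[of "fst p" "snd p"] by auto
  qed
  moreover have "card ?F = 3" using ne triple_pairs(4) ST(1) by simp
  moreover have "?F \<subseteq> a" using triple_pairs by simp
  ultimately have card_a: "card a = card ?rest + 3"
    using card_Diff_subset[of ?F a] card_mono[of a ?F] fin by simp
  have "collapse a H = insert (?W, {}) ?rest" by (simp add: collapse_def sides_union Un_assoc)
  moreover have "(?W, {}) \<notin> ?rest"
    using collapse_disjoint[of ?W "{}"] triple_pairs(4) by auto
  ultimately have "card (collapse a H) = card ?rest + 1" using fin by simp
  moreover have "card (hybrids a) = card (hybrids (collapse a H)) + 1"
    using card_Suc_Diff1[OF finite_hybrids[OF fin] H] by (simp add: hybrids_collapse)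
  ultimately show ?thesis using card_a by (simp add: cactus_rank_def)
qed

end

context
  fixes X :: "'a set" and a :: "'a set_pair set" and A B K :: "'a set"
  assumes pa: "partition_like X a" and A: "(A, K) \<in> a" and B: "(B, {}) \<in> a"
    and AB: "A \<noteq> B" "A \<notin> hybrids a" "B \<notin> hybrids a"
begin

lemma merge_pair_iff:
  "(U, L) \<in> merge a A K B \<longleftrightarrow> U = A \<union> B \<and> L = K \<or> (U, L) \<in> a \<and> U \<noteq> A \<and> U \<noteq> B"
  using A B unique_hybrid[OF pa, of A L K] unique_hybrid[OF pa, of B L "{}"]
  by (auto simp: merge_def)

lemma merge_disjoint: "(U, L) \<in> a \<Longrightarrow> U \<noteq> A \<Longrightarrow> U \<noteq> B \<Longrightarrow> U \<inter> (A \<union> B) = {}"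
  using same_block[OF pa _ A] same_block[OF pa _ B] by blast

lemma hybrids_merge: "hybrids (merge a A K B) = hybrids a"
proof (rule set_eqI)
  fix H
  show "H \<in> hybrids (merge a A K B) \<longleftrightarrow> H \<in> hybrids a"
  proof
    assume "H \<in> hybrids (merge a A K B)"
    then show "H \<in> hybrids a" using A unfolding hybrids_iff merge_pair_iff by blast
  next
    assume "H \<in> hybrids a"
    then obtain U where U: "(U, H) \<in> a" "H \<noteq> {}" unfolding hybrids_iff by blast
    have "U \<noteq> B" using unique_hybrid[OF pa B] U by blast
    moreover have "U = A \<longrightarrow> H = K" using unique_hybrid[OF pa A] U by blast
    ultimately show "H \<in> hybrids (merge a A K B)"
      using U unfolding hybrids_iff merge_pair_iff by blast
  qed
qed

lemma partition_like_merge: "partition_like X (merge a A K B)"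
  unfolding partition_like_iff hybrids_merge
proof (intro conjI allI impI ballI)
  have "B \<inter> K = {}"
  proof (cases "K = {}")
    case False
    then have "K \<in> hybrids a" using A by (auto simp: hybrids_iff)
    then show ?thesis using AB(3) hybrid_block[OF pa] same_block[OF pa B] by blast
  qed simp
  fix U L assume U: "(U, L) \<in> merge a A K B"
  then have "U \<subseteq> X \<and> L \<subseteq> X \<and> U \<noteq> {} \<and> U \<inter> L = {}"
    unfolding merge_pair_iff
  proof (elim disjE conjE)
    assume "(U, L) \<in> a"
    then show ?thesis using pair_sub[OF pa] by simp
  qed (use pair_sub[OF pa A] pair_sub[OF pa B] \<open>B \<inter> K = {}\<close> in \<open>simp add: Int_Un_distrib2\<close>)
  then show "U \<subseteq> X" "L \<subseteq> X" "U \<noteq> {}" "U \<inter> L = {}" by simp_all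
next
  fix U L V M assume "(U, L) \<in> merge a A K B \<and> (V, M) \<in> merge a A K B \<and> U \<inter> V \<noteq> {}"
  note meet = this
  have repl: "U = A \<union> B \<and> L = K \<or> (U, L) \<in> a \<and> U \<inter> (A \<union> B) = {}"
    if "(U, L) \<in> merge a A K B" for U L
    using that unfolding merge_pair_iff
    by (elim disjE conjE) (simp, intro disjI2 conjI merge_disjoint)
  have "U = V \<and> L = M"
    by (rule meet_replaced[OF pa, of "merge a A K B" "A \<union> B" K]) (use repl meet in simp_all)
  then show "U = V" "L = M" by simp_all
next
  fix z assume "z \<in> X"
  then obtain U L where "(U, L) \<in> a" "z \<in> U" using block_of[OF pa] by blast
  then show "\<exists>U L. (U, L) \<in> merge a A K B \<and> z \<in> U"
    unfolding merge_pair_iff by (cases "U = A \<or> U = B") blast+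
next
  fix H assume H: "H \<in> hybrids a"
  then show "(H, {}) \<in> merge a A K B"
    unfolding merge_pair_iff using hybrid_block[OF pa H] AB(2,3) by blast
  have "H \<noteq> {}" using H by (simp add: hybrids_iff)
  have not_B: "(B, H) \<notin> a" using unique_hybrid[OF pa B] \<open>H \<noteq> {}\<close> by blast
  show "\<exists>S T. S \<noteq> T \<and> (\<forall>U. (U, H) \<in> merge a A K B \<longleftrightarrow> U = S \<or> U = T)"
  proof (cases "H = K")
    case False
    then have "(A, H) \<notin> a" using unique_hybrid[OF pa A] by blast
    then have "(U, H) \<in> merge a A K B \<longleftrightarrow> (U, H) \<in> a" for U
      using False not_B unfolding merge_pair_iff by blast
    then show ?thesis using hybrid_sides[OF pa H] by simp
  next
    case True
    then obtain T where T: "T \<noteq> A" "\<And>U. (U, H) \<in> a \<longleftrightarrow> U = A \<or> U = T"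
      using other_side[OF pa A] \<open>H \<noteq> {}\<close> by blast
    then have "T \<noteq> B" using not_B by blast
    then have "A \<union> B \<noteq> T" using merge_disjoint[of T H] T pair_sub(3)[OF pa A] by blast
    moreover have "(U, H) \<in> merge a A K B \<longleftrightarrow> U = A \<union> B \<or> U = T" for U
      unfolding merge_pair_iff T(2) by (cases "U = T") (simp_all add: True T(1) \<open>T \<noteq> B\<close> cong: conj_cong)
    ultimately show ?thesis by (intro exI[of _ "A \<union> B"] exI[of _ T]) simp
  qed
qed

lemma le_merge: "system_le a (merge a A K B)"
  unfolding system_le_iff[OF pa]
proof (intro conjI allI impI)
  fix U L assume U: "(U, L) \<in> a"
  then show "\<exists>V M. (V, M) \<in> merge a A K B \<and> U \<subseteq> V \<and> (L \<subseteq> V \<or> L = M)"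
    using unique_hybrid[OF pa U, of K] unique_hybrid[OF pa U, of "{}"] A B
    unfolding merge_pair_iff by (cases "U = A \<or> U = B") blast+
next
  fix U L assume "(U, L) \<in> merge a A K B \<and> L \<in> hybrids a"
  then show "\<exists>S. (S, L) \<in> a \<and> S \<subseteq> U" using A unfolding merge_pair_iff by blast
qed

text \<open>As \<open>K\<close> remains a hybrid of \<open>b\<close>, the block of \<open>b\<close> that contains \<open>A\<close> is a side of \<open>K\<close> as well; hence the
  enlarged side fits into it.\<close>

lemma merge_le:
  assumes pb: "partition_like X b" and le: "system_le a b" and kept: "hybrids a \<subseteq> hybrids b"
    and T: "(T, L) \<in> b" "A \<union> B \<subseteq> T"
  shows "system_le (merge a A K B) b"
  unfolding system_le_iff[OF partition_like_merge] hybrids_merge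
proof (intro conjI allI impI)
  have same: "U = T" if "(U, M) \<in> b" "A \<subseteq> U" for U M
    using same_block[OF pb that(1) T(1)] that(2) T(2) pair_sub(3)[OF pa A] by blast
  have K: "K = {} \<or> (T, K) \<in> b"
  proof (cases "K = {}")
    case False
    then have "K \<in> hybrids a" using A unfolding hybrids_iff by blast
    then have "K \<in> hybrids b" using kept by blast
    then show ?thesis using kept_side[OF pa pb le A] same by blast
  qed simp
  fix U M assume "(U, M) \<in> merge a A K B"
  then consider "U = A \<union> B" "M = K" | "(U, M) \<in> a" unfolding merge_pair_iff by blast
  then show "\<exists>V N. (V, N) \<in> b \<and> U \<subseteq> V \<and> (M \<subseteq> V \<or> M = N)"
  proof cases
    case 1
    then show ?thesis using K T by blast
  next
    case 2
    then show ?thesis using le_pair[OF pa pb le] by blast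
  qed
next
  fix U M assume U: "(U, M) \<in> b \<and> M \<in> hybrids a"
  then obtain S where S: "(S, M) \<in> a" "S \<subseteq> U" using le_side[OF pa pb le] by blast
  have "S \<noteq> B" using unique_hybrid[OF pa B] S(1) U by (auto simp: hybrids_iff)
  show "\<exists>S. (S, M) \<in> merge a A K B \<and> S \<subseteq> U"
  proof (cases "S = A")
    case True
    then have "U = T" using same_block[OF pb _ T(1)] U S(2) T(2) pair_sub(3)[OF pa A] by blast
    moreover have "M = K" using True S(1) unique_hybrid[OF pa A] by blast
    ultimately show ?thesis using T(2) merge_pair_iff by blast
  next
    case False
    then show ?thesis using S \<open>S \<noteq> B\<close> merge_pair_iff by blast
  qed
qed

lemma cactus_rank_merge:
  assumes "finite X"
  shows "cactus_rank (merge a A K B) = cactus_rank a + 1"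
proof -
  have fin: "finite a" using finite_system[OF pa assms] .
  have "(A \<union> B, K) \<notin> a - {(A, K), (B, {})}"
  proof
    assume in_rest: "(A \<union> B, K) \<in> a - {(A, K), (B, {})}"
    then have "A \<union> B \<noteq> A" by auto
    moreover have "A \<union> B \<noteq> B" using in_rest unique_hybrid[OF pa B, of K] by auto
    ultimately show False
      using merge_disjoint[of "A \<union> B" K] in_rest pair_sub(3)[OF pa A] by simp
  qed
  moreover have "card a = card (a - {(A, K), (B, {})}) + 2"
    using card_Diff_subset[of "{(A, K), (B, {})}" a] card_mono[of a "{(A, K), (B, {})}"] fin A B AB(1)
    by simp
  ultimately have "card a = card (merge a A K B) + 1" using fin by (simp add: merge_def)
  then show ?thesis by (simp add: cactus_rank_def hybrids_merge)
qed

end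

context
  fixes X :: "'a set" and a :: "'a set_pair set" and S T H :: "'a set"
  assumes pa: "partition_like X a" and S: "(S, {}) \<in> a" and T: "(T, {}) \<in> a" and H: "(H, {}) \<in> a"
    and distinct: "S \<noteq> T" "S \<noteq> H" "T \<noteq> H"
    and free: "S \<notin> hybrids a" "T \<notin> hybrids a" "H \<notin> hybrids a"
begin

lemma spawn_pair_iff:
  "(U, L) \<in> spawn a S T H \<longleftrightarrow> (U = S \<or> U = T) \<and> L = H \<or> (U, L) \<in> a \<and> U \<noteq> S \<and> U \<noteq> T"
  unfolding spawn_def insert_iff Diff_iff prod.inject empty_iff
  using unique_hybrid[OF pa S, of L] unique_hybrid[OF pa T, of L] by blast

lemma hybrids_spawn: "hybrids (spawn a S T H) = insert H (hybrids a)"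
proof (rule set_eqI)
  fix L
  show "L \<in> hybrids (spawn a S T H) \<longleftrightarrow> L \<in> insert H (hybrids a)"
  proof
    assume "L \<in> hybrids (spawn a S T H)"
    then show "L \<in> insert H (hybrids a)" unfolding hybrids_iff spawn_pair_iff by (auto simp: hybrids_iff)
  next
    assume L: "L \<in> insert H (hybrids a)"
    show "L \<in> hybrids (spawn a S T H)"
    proof (cases "L = H")
      case True
      then show ?thesis using pair_sub(3)[OF pa H] unfolding hybrids_iff spawn_pair_iff by blast
    next
      case False
      then obtain U where U: "(U, L) \<in> a" "L \<noteq> {}" using L unfolding insert_iff hybrids_iff by blast
      then have "U \<noteq> S" "U \<noteq> T" using unique_hybrid[OF pa S] unique_hybrid[OF pa T] by blast+
      then show ?thesis using U unfolding hybrids_iff spawn_pair_iff by blast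
    qed
  qed
qed

lemma partition_like_spawn: "partition_like X (spawn a S T H)"
  unfolding partition_like_iff hybrids_spawn
proof (intro conjI allI impI ballI)
  have ST: "S \<inter> H = {}" "T \<inter> H = {}" using same_block[OF pa _ H] S T distinct by blast+
  fix U L assume U: "(U, L) \<in> spawn a S T H"
  then have "U \<subseteq> X \<and> L \<subseteq> X \<and> U \<noteq> {} \<and> U \<inter> L = {}"
    unfolding spawn_pair_iff
  proof (elim disjE conjE)
    assume "(U, L) \<in> a"
    then show ?thesis using pair_sub[OF pa] by simp
  qed (use pair_sub[OF pa S] pair_sub[OF pa T] pair_sub[OF pa H] ST in simp_all)
  then show "U \<subseteq> X" "L \<subseteq> X" "U \<noteq> {}" "U \<inter> L = {}" by simp_all
next
  fix U L V M assume UV: "(U, L) \<in> spawn a S T H \<and> (V, M) \<in> spawn a S T H \<and> U \<inter> V \<noteq> {}"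
  have "\<exists>L'. (U, L') \<in> a" if "(U, L) \<in> spawn a S T H" for U L
    using that S T unfolding spawn_pair_iff by blast
  then obtain L' M' where "(U, L') \<in> a" "(V, M') \<in> a" using UV by meson
  then have "U = V" using meeting_blocks[OF pa] UV by blast
  moreover have "L = M"
  proof -
    have "(U, L) \<in> spawn a S T H" "(U, M) \<in> spawn a S T H" using UV \<open>U = V\<close> by simp_all
    then show ?thesis
      using unique_hybrid[OF pa, of U L M] unfolding spawn_pair_iff by (cases "U = S"; cases "U = T") simp_all
  qed
  ultimately have "U = V \<and> L = M" ..
  then show "U = V" "L = M" by simp_all
next
  fix z assume "z \<in> X"
  then obtain U L where "(U, L) \<in> a" "z \<in> U" using block_of[OF pa] by blast
  then show "\<exists>U L. (U, L) \<in> spawn a S T H \<and> z \<in> U"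
    unfolding spawn_pair_iff by (cases "U = S \<or> U = T") blast+
next
  fix L assume L: "L \<in> insert H (hybrids a)"
  then show "(L, {}) \<in> spawn a S T H"
    unfolding spawn_pair_iff using hybrid_block[OF pa, of L] H distinct free by blast
  show "\<exists>V W. V \<noteq> W \<and> (\<forall>U. (U, L) \<in> spawn a S T H \<longleftrightarrow> U = V \<or> U = W)"
  proof (cases "L = H")
    case True
    have "(U, H) \<notin> a" for U using free(3) pair_sub(3)[OF pa H] by (auto simp: hybrids_iff)
    then show ?thesis using True distinct(1) unfolding spawn_pair_iff by blast
  next
    case False
    then have "L \<in> hybrids a" "L \<noteq> {}" using L by (auto simp: hybrids_iff)
    moreover have "(U, L) \<in> spawn a S T H \<longleftrightarrow> (U, L) \<in> a" for U
      unfolding spawn_pair_iff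
      using False \<open>L \<noteq> {}\<close> unique_hybrid[OF pa S] unique_hybrid[OF pa T] by blast
    ultimately show ?thesis using hybrid_sides[OF pa] by simp
  qed
qed

lemma le_spawn: "system_le a (spawn a S T H)"
  unfolding system_le_iff[OF pa]
proof (intro conjI allI impI)
  fix U L assume U: "(U, L) \<in> a"
  then show "\<exists>V M. (V, M) \<in> spawn a S T H \<and> U \<subseteq> V \<and> (L \<subseteq> V \<or> L = M)"
    using unique_hybrid[OF pa U, of "{}"] S T
    unfolding spawn_pair_iff by (cases "U = S \<or> U = T") blast+
next
  fix U L assume "(U, L) \<in> spawn a S T H \<and> L \<in> hybrids a"
  then show "\<exists>S. (S, L) \<in> a \<and> S \<subseteq> U" using free(3) unfolding spawn_pair_iff by blast
qed

text \<open>The blocks \<open>S\<close> and \<open>T\<close> exhaust the sides of \<open>H\<close> in \<open>b\<close>, so (SP2) holds for the new triple.\<close>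

lemma spawn_le:
  assumes pb: "partition_like X b" and le: "system_le a b" and "(S, H) \<in> b" "(T, H) \<in> b"
  shows "system_le (spawn a S T H) b"
  unfolding system_le_iff[OF partition_like_spawn] hybrids_spawn
proof (intro conjI allI impI)
  fix U L assume "(U, L) \<in> spawn a S T H"
  then show "\<exists>V M. (V, M) \<in> b \<and> U \<subseteq> V \<and> (L \<subseteq> V \<or> L = M)"
    unfolding spawn_pair_iff
  proof (elim disjE conjE)
    assume "(U, L) \<in> a"
    then show ?thesis using le_pair[OF pa pb le] by blast
  qed (use assms(3,4) in blast)+
next
  fix U L assume U: "(U, L) \<in> b \<and> L \<in> insert H (hybrids a)"
  show "\<exists>V. (V, L) \<in> spawn a S T H \<and> V \<subseteq> U"
  proof (cases "L = H")
    case True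
    have "H \<in> hybrids b" using assms(3) pair_sub(3)[OF pa H] by (auto simp: hybrids_iff)
    then obtain P where P: "\<And>V. (V, H) \<in> b \<longleftrightarrow> V = S \<or> V = P"
      using other_side[OF pb assms(3)] unfolding hybrids_iff by blast
    then have "P = T" using P[of T] assms(4) distinct(1) by simp
    then have "U = S \<or> U = T" using P[of U] U True by simp
    then show ?thesis using True unfolding spawn_pair_iff by blast
  next
    case False
    then have L: "L \<in> hybrids a" "L \<noteq> {}" using U by (auto simp: hybrids_iff)
    then obtain V where V: "(V, L) \<in> a" "V \<subseteq> U" using le_side[OF pa pb le] U by blast
    then have "V \<noteq> S" "V \<noteq> T"
      using L(2) unique_hybrid[OF pa S, of L] unique_hybrid[OF pa T, of L] by blast+
    then show ?thesis using V unfolding spawn_pair_iff by blast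
  qed
qed

lemma cactus_rank_spawn:
  assumes "finite X"
  shows "cactus_rank (spawn a S T H) = cactus_rank a + 1"
proof -
  have fin: "finite a" using finite_system[OF pa assms] .
  have "H \<noteq> {}" using pair_sub(3)[OF pa H] .
  then have "(U, H) \<notin> a" for U using free(3) by (auto simp: hybrids_iff)
  moreover have "card a = card (a - {(S, {}), (T, {})}) + 2"
    using card_Diff_subset[of "{(S, {}), (T, {})}" a] card_mono[of a "{(S, {}), (T, {})}"] fin S T distinct(1)
    by simp
  ultimately have "card (spawn a S T H) = card a" using fin distinct(1) by (simp add: spawn_def)
  then show ?thesis
    using free(3) finite_hybrids[OF fin] by (simp add: cactus_rank_def hybrids_spawn)
qed

end

section \<open>The labels\<close>

text \<open>Disjoint blocks have different minima, so the minima can stand for the blocks. Going up in the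
  order deletes minima, namely those of the blocks that are joined to a block with a smaller minimum.\<close>

definition minima :: "nat set_pair set \<Rightarrow> nat set" where
  "minima a = (\<lambda>p. Min (fst p)) ` a"

text \<open>The least label of a move from \<open>a\<close> towards \<open>b\<close>. The three cases are: some triple still has to be
  collapsed, all collapses are done but some blocks still have to be merged, and only new triples have to
  be spawned. The values of the cases lie in \<open>{1..n}\<close>, \<open>{n+1..2*n}\<close> and above \<open>2 * n\<close>.\<close>

definition cactus_label :: "nat \<Rightarrow> nat set_pair set \<times> nat set_pair set \<Rightarrow> nat" where
  "cactus_label n = (\<lambda>(a, b).
     if \<not> hybrids a \<subseteq> hybrids b then Min (\<Union>(hybrids a - hybrids b))
     else if \<not> minima a \<subseteq> minima b then n + Min (minima a - minima b)
     else 2 * n + Min (\<Union>(hybrids b - hybrids a)))"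

lemma minima_iff: "m \<in> minima a \<longleftrightarrow> (\<exists>S H. (S, H) \<in> a \<and> m = Min S)"
  by (force simp: minima_def)

context
  fixes n :: nat
begin

abbreviation cactus :: "nat set_pair set \<Rightarrow> bool" where
  "cactus \<equiv> partition_like {1..n}"

abbreviation lab :: "nat set_pair set \<Rightarrow> nat set_pair set \<Rightarrow> nat" where
  "lab a b \<equiv> cactus_label n (a, b)"

lemma block_Min:
  assumes "cactus a" "(S, H) \<in> a"
  shows "finite S" "Min S \<in> S" "Min S \<in> {1..n}"
proof -
  show "finite S" using pair_sub(1)[OF assms] finite_subset by blast
  then show "Min S \<in> S" using pair_sub(3)[OF assms] Min_in by blast
  then show "Min S \<in> {1..n}" using pair_sub(1)[OF assms] by blast
qed

lemma minima_range: "cactus a \<Longrightarrow> minima a \<subseteq> {1..n}"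
  using block_Min(3) by (auto simp: minima_iff)

lemma Min_unique:
  assumes "cactus a" "(S, H) \<in> a" "(T, K) \<in> a" "Min S = Min T"
  shows "S = T"
  using same_block[OF assms(1-3)] block_Min(2)[OF assms(1,2)] block_Min(2)[OF assms(1,3)] assms(4)
  by metis

lemma hybrids_range: "cactus a \<Longrightarrow> \<Union>(hybrids a) \<subseteq> {1..n}"
  using pair_sub(1) hybrid_block by blast

lemma Union_hybrids_nonempty:
  assumes "H \<in> hybrids a" "H \<in> \<H>"
  shows "\<Union>\<H> \<noteq> {}"
proof -
  have "H \<noteq> {}" using assms(1) by (simp add: hybrids_iff)
  then show ?thesis using assms(2) by auto
qed

text \<open>The minimum \<open>m\<close> of a block \<open>T\<close> of \<open>b\<close> lies in a block of \<open>a\<close> that is contained in \<open>T\<close>, so it is the minimum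
  of that block too.\<close>

lemma minima_anti:
  assumes "cactus a" "cactus b" "system_le a b"
  shows "minima b \<subseteq> minima a"
proof
  fix m assume "m \<in> minima b"
  then obtain T K where T: "(T, K) \<in> b" "m = Min T" by (auto simp: minima_iff)
  note mT = block_Min[OF assms(2) T(1), folded T(2)]
  obtain S H where S: "(S, H) \<in> a" "m \<in> S" using block_of[OF assms(1) mT(3)] by blast
  have "S \<subseteq> T" using le_block[OF assms S(1) T(1) S(2) mT(2)] .
  then have "Min S = m"
    using T(2) S(2) mT(1) block_Min(1,2)[OF assms(1) S(1)] by (metis Min_le antisym subsetD)
  then show "m \<in> minima a" using S(1) unfolding minima_iff by blast
qed

text \<open>Every block of \<open>a\<close> inside \<open>T\<close> has a minimum that is the minimum of some block of \<open>b\<close>, necessarily of \<open>T\<close>.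
  So all these blocks share the point \<open>Min T\<close> and coincide.\<close>

lemma same_minima_block:
  assumes "cactus a" "cactus b" "system_le a b" "minima a \<subseteq> minima b"
    and S: "(S, H) \<in> a" and T: "(T, K) \<in> b" and "S \<subseteq> T"
  shows "S = T"
proof -
  have min: "Min T \<in> U" if U: "(U, L) \<in> a" "U \<subseteq> T" for U L
  proof -
    note mU = block_Min[OF assms(1) U(1)]
    have "Min U \<in> minima b" using assms(4) U(1) unfolding minima_iff subset_iff by blast
    then obtain V M where V: "(V, M) \<in> b" "Min U = Min V" unfolding minima_iff by blast
    then have "Min U \<in> V" using block_Min(2)[OF assms(2) V(1)] by simp
    then have "V = T" using same_block[OF assms(2) V(1) T] U(2) mU(2) by blast
    then show ?thesis using V(2) mU(2) by simp
  qed
  show ?thesis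
  proof
    show "T \<subseteq> S"
    proof
      fix z assume z: "z \<in> T"
      obtain U L where U: "(U, L) \<in> a" "z \<in> U"
        using block_of[OF assms(1)] pair_sub(1)[OF assms(2) T] z by blast
      have "U \<subseteq> T" using le_block[OF assms(1-3) U(1) T U(2) z] .
      then have "U = S" using same_block[OF assms(1) U(1) S] min[OF U(1)] min[OF S assms(7)] by blast
      then show "z \<in> S" using U(2) by simp
    qed
  qed fact
qed

lemma same_hybrids_minima_eq:
  assumes "cactus a" "cactus b" "system_le a b" "minima a \<subseteq> minima b" "hybrids a = hybrids b"
  shows "a = b"
proof -
  have sub: "(S, H) \<in> b" if S: "(S, H) \<in> a" for S H
  proof -
    obtain T K where T: "(T, K) \<in> b" "S \<subseteq> T" "H \<subseteq> T \<or> H = K" using le_pair[OF assms(1-3) S] by blast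
    have "S = T" using same_minima_block[OF assms(1-4) S T(1,2)] .
    have "H = K"
    proof (rule ccontr)
      assume "H \<noteq> K"
      then have "H = {}" using T(3) \<open>S = T\<close> pair_sub(4)[OF assms(1) S] by blast
      then have "K \<noteq> {}" using \<open>H \<noteq> K\<close> by simp
      then have "K \<in> hybrids a" using T(1) unfolding assms(5) hybrids_iff by blast
      then obtain U where U: "(U, K) \<in> a" "U \<subseteq> T" using le_side[OF assms(1-3) T(1)] by blast
      then have "U = S" using same_minima_block[OF assms(1-4) U(1) T(1) U(2)] \<open>S = T\<close> by simp
      then show False using unique_hybrid[OF assms(1) S] U(1) \<open>H \<noteq> K\<close> by blast
    qed
    then show ?thesis using T(1) \<open>S = T\<close> by simp
  qed
  have "(T, K) \<in> a" if T: "(T, K) \<in> b" for T K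
  proof -
    obtain S H where S: "(S, H) \<in> a" "Min T \<in> S"
      using block_of[OF assms(1) block_Min(3)[OF assms(2) T]] by blast
    then have "S = T \<and> H = K"
      using same_block[OF assms(2) sub[OF S(1)] T S(2)] block_Min(2)[OF assms(2) T] by blast
    then show ?thesis using S(1) by simp
  qed
  then show ?thesis using sub by auto
qed

text \<open>When the partitions of \<open>a\<close> and \<open>b\<close> agree, nothing in between can be absorbed, so every triple of \<open>y\<close>
  survives in \<open>b\<close>.\<close>

lemma hybrids_between:
  assumes "cactus a" "cactus y" "cactus b" "system_le a y" "system_le y b" 
    and "minima a \<subseteq> minima b"
  shows "hybrids y \<subseteq> hybrids b"
proof
  fix H assume H: "H \<in> hybrids y"
  obtain S where S: "(S, H) \<in> y" "H \<noteq> {}" using H unfolding hybrids_iff by blast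
  show "H \<in> hybrids b"
  proof (rule ccontr)
    assume "H \<notin> hybrids b"
    then obtain T K where T: "(T, K) \<in> b" "S \<union> H \<subseteq> T"
      using lost_side[OF assms(2,3,5) S(1)] by blast
    have "minima y \<subseteq> minima b" using minima_anti[OF assms(1,2,4)] assms(6) by blast
    then have "S = T" using same_minima_block[OF assms(2,3,5) _ S(1) T(1)] T(2) by blast
    then show False using T(2) S(2) pair_sub(4)[OF assms(2) S(1)] by blast
  qed
qed

text \<open>The next three lemmas describe the label in each of its three cases: its value is attained in the
  relevant set, it lies in the range of the case, and it is minimal there. In the third case the set is
  nonempty because \<open>a\<close> and \<open>b\<close> would be equal otherwise.\<close>

lemma lab_lost:
  assumes "cactus a" "\<not> hybrids a \<subseteq> hybrids b"
  shows "lab a b \<in> \<Union>(hybrids a - hybrids b)" "lab a b \<in> {1..n}"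
    "h \<in> \<Union>(hybrids a - hybrids b) \<Longrightarrow> lab a b \<le> h"
proof -
  have "\<Union>(hybrids a - hybrids b) \<subseteq> {1..n}" using hybrids_range[OF assms(1)] by blast
  then have fin: "finite (\<Union>(hybrids a - hybrids b))" by (rule finite_subset) simp
  have lab: "lab a b = Min (\<Union>(hybrids a - hybrids b))" using assms(2) by (simp add: cactus_label_def)
  have "\<Union>(hybrids a - hybrids b) \<noteq> {}" using assms(2) Union_hybrids_nonempty by blast
  then show mem: "lab a b \<in> \<Union>(hybrids a - hybrids b)" using Min_in[OF fin] lab by simp
  then show "lab a b \<in> {1..n}" using hybrids_range[OF assms(1)] by blast
  show "lab a b \<le> h" if "h \<in> \<Union>(hybrids a - hybrids b)" using Min_le[OF fin that] lab by simp
qed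

lemma lab_gone:
  assumes "cactus a" "hybrids a \<subseteq> hybrids b" "\<not> minima a \<subseteq> minima b"
  shows "lab a b - n \<in> minima a - minima b" "lab a b \<in> {n+1..2*n}"
    "m \<in> minima a - minima b \<Longrightarrow> lab a b \<le> n + m"
proof -
  have "minima a - minima b \<subseteq> {1..n}" using minima_range[OF assms(1)] by blast
  then have fin: "finite (minima a - minima b)" by (rule finite_subset) simp
  have lab: "lab a b = n + Min (minima a - minima b)" using assms(2,3) by (simp add: cactus_label_def)
  have "minima a - minima b \<noteq> {}" using assms(3) by auto
  then have mem: "Min (minima a - minima b) \<in> minima a - minima b" using Min_in[OF fin] by simp
  then show "lab a b - n \<in> minima a - minima b" using lab by simp
  show "lab a b \<in> {n+1..2*n}" using mem minima_range[OF assms(1)] lab by auto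
  show "lab a b \<le> n + m" if "m \<in> minima a - minima b" using Min_le[OF fin that] lab by simp
qed

lemma lab_new:
  assumes "cactus a" "cactus b" "system_le a b" "a \<noteq> b" "hybrids a \<subseteq> hybrids b" "minima a \<subseteq> minima b"
  shows "lab a b - 2*n \<in> \<Union>(hybrids b - hybrids a)" "2*n < lab a b"
    "h \<in> \<Union>(hybrids b - hybrids a) \<Longrightarrow> lab a b \<le> 2*n + h"
proof -
  have "\<Union>(hybrids b - hybrids a) \<subseteq> {1..n}" using hybrids_range[OF assms(2)] by blast
  then have fin: "finite (\<Union>(hybrids b - hybrids a))" by (rule finite_subset) simp
  have lab: "lab a b = 2*n + Min (\<Union>(hybrids b - hybrids a))"
    using assms(5,6) by (simp add: cactus_label_def)
  have "\<not> hybrids b \<subseteq> hybrids a"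
    using same_hybrids_minima_eq[OF assms(1-3,6)] assms(4,5) by blast
  then have "\<Union>(hybrids b - hybrids a) \<noteq> {}" using Union_hybrids_nonempty by blast
  then have mem: "Min (\<Union>(hybrids b - hybrids a)) \<in> \<Union>(hybrids b - hybrids a)" using Min_in[OF fin] by simp
  then show "lab a b - 2*n \<in> \<Union>(hybrids b - hybrids a)" using lab by simp
  have "Min (\<Union>(hybrids b - hybrids a)) \<in> {1..n}" using mem hybrids_range[OF assms(2)] by blast
  then show "2*n < lab a b" using lab by simp
  show "lab a b \<le> 2*n + h" if "h \<in> \<Union>(hybrids b - hybrids a)" using Min_le[OF fin that] lab by simp
qed

text \<open>The hybrids lost, minima deleted and hybrids created between \<open>a\<close> and \<open>y\<close> recur between \<open>a\<close> and \<open>b\<close> (the last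
  ones provided that \<open>a\<close> and \<open>b\<close> have the same minima), which gives \<open>lab a b \<le> lab a y\<close>. The element that attains \<open>lab a b\<close> is dealt with either between \<open>a\<close> and \<open>y\<close>,
  and then the labels agree, or it is still pending between \<open>y\<close> and \<open>b\<close>. In the latter case \<open>lab y b\<close> is
  at most \<open>lab a b\<close>; it may be smaller, because \<open>y\<close> may have new hybrids that are lost again in \<open>b\<close>.\<close>

lemma lab_triangle:
  assumes "cactus a" "cactus y" "cactus b" "system_le a y" "system_le y b" "a \<noteq> y" "y \<noteq> b"
  shows "lab a b \<le> lab a y \<and> (lab a y = lab a b \<or> lab y b \<le> lab a y)"
proof -
  have ab: "system_le a b" "a \<noteq> b"
    using system_le_trans[OF assms(1-5)] system_le_subset[of "{1..n}"] assms by blast+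
  have lost: "hybrids a - hybrids y \<subseteq> hybrids a - hybrids b"
    using lost_stays_lost[OF assms(1-5)] by blast
  have mins: "minima b \<subseteq> minima y" "minima y \<subseteq> minima a" using minima_anti assms by blast+
  consider (lost) "\<not> hybrids a \<subseteq> hybrids b" | (gone) "hybrids a \<subseteq> hybrids b" "\<not> minima a \<subseteq> minima b"
    | (new) "hybrids a \<subseteq> hybrids b" "minima a \<subseteq> minima b" by blast
  then show ?thesis
  proof cases
    case lost
    note l = lab_lost[OF assms(1) lost]
    show ?thesis
    proof (cases "hybrids a \<subseteq> hybrids y")
      case True
      have "n < lab a y"
        using lab_gone(2)[OF assms(1) True] lab_new(2)[OF assms(1,2,4,6) True] l(2)
        by (cases "minima a \<subseteq> minima y") auto
      moreover have "\<not> hybrids y \<subseteq> hybrids b" using lost True by blast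
      ultimately show ?thesis using l(2) lab_lost(2)[OF assms(2), of b] by simp
    next
      case False
      note ly = lab_lost[OF assms(1) False]
      have le: "lab a b \<le> lab a y" using l(3) ly(1) \<open>hybrids a - hybrids y \<subseteq> _\<close> by blast
      obtain H where H: "H \<in> hybrids a" "H \<notin> hybrids b" "lab a b \<in> H" using l(1) by blast
      show ?thesis
      proof (cases "H \<in> hybrids y")
        case True
        then have "\<not> hybrids y \<subseteq> hybrids b" "lab a b \<in> \<Union>(hybrids y - hybrids b)" using H by blast+
        then show ?thesis using lab_lost(3)[OF assms(2)] le by fastforce
      next
        case False
        then show ?thesis using ly(3)[of "lab a b"] H le by fastforce
      qed
    qed
  next
    case gone
    note g = lab_gone[OF assms(1) gone]
    have ay: "hybrids a \<subseteq> hybrids y" using lost gone(1) by blast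
    have gone_le: "lab y b \<le> lab a b" if "lab a b - n \<notin> minima a - minima y"
    proof (cases "hybrids y \<subseteq> hybrids b")
      case True
      have "lab a b - n \<in> minima y - minima b" using that g(1) by blast
      then show ?thesis using lab_gone(3)[OF assms(2) True] g(2) by fastforce
    next
      case False
      then show ?thesis using lab_lost(2)[OF assms(2)] g(2) by fastforce
    qed
    show ?thesis
    proof (cases "minima a \<subseteq> minima y")
      case True
      then have "2*n < lab a y" using lab_new(2)[OF assms(1,2,4,6) ay] by simp
      moreover have "lab y b \<le> lab a b" using gone_le True by blast
      ultimately show ?thesis using g(2) by simp
    next
      case False
      note gy = lab_gone[OF assms(1) ay False]
      have le: "lab a b \<le> lab a y" using g(3)[of "lab a y - n"] gy(1,2) mins(1) by fastforce
      show ?thesis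
      proof (cases "lab a b - n \<in> minima a - minima y")
        case True
        then show ?thesis using gy(3) g(2) le by fastforce
      next
        case False
        then show ?thesis using gone_le le by simp
      qed
    qed
  next
    case new
    have yb: "hybrids y \<subseteq> hybrids b" using hybrids_between[OF assms(1-5) new(2)] .
    have ay: "hybrids a \<subseteq> hybrids y" "minima a \<subseteq> minima y" "minima y \<subseteq> minima b"
      using lost new mins by blast+
    note w = lab_new[OF assms(1,3) ab new] and way = lab_new[OF assms(1,2,4,6) ay(1,2)]
      and wyb = lab_new[OF assms(2,3,5,7) yb ay(3)]
    have le: "lab a b \<le> lab a y" using w(3)[of "lab a y - 2*n"] way(1,2) yb by fastforce
    consider "lab a b - 2*n \<in> \<Union>(hybrids y - hybrids a)" | "lab a b - 2*n \<in> \<Union>(hybrids b - hybrids y)"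
      using w(1) by blast
    then show ?thesis
      by cases (use way(3) wyb(3) w(2) le in fastforce)+
  qed
qed

section \<open>The step of least label\<close>

definition least_step :: "nat set_pair set \<Rightarrow> nat set_pair set \<Rightarrow> nat set_pair set \<Rightarrow> bool" where
  "least_step a b x \<longleftrightarrow> cactus x \<and> system_le a x \<and> system_le x b \<and> cactus_rank x = cactus_rank a + 1 \<and>
     lab a x = lab a b \<and> (x \<noteq> b \<longrightarrow> lab a b < lab x b) \<and>
     (\<forall>y. cactus y \<and> system_le a y \<and> a \<noteq> y \<and> system_le y b \<and> lab a y = lab a b \<longrightarrow> system_le x y)"

text \<open>Collapse the triple whose hybrid \<open>H\<close> contains \<open>lab a b\<close>. Hybrids are disjoint, so this point determines
  \<open>H\<close>: any \<open>y\<close> with the same label has lost \<open>H\<close> as well and hence lies above the collapse, and the hybrids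
  that are still to be lost have different, larger minima.\<close>

lemma least_step_lost:
  assumes ca: "cactus a" and cb: "cactus b" and le: "system_le a b" and lost: "\<not> hybrids a \<subseteq> hybrids b"
  shows "\<exists>x. least_step a b x"
proof -
  note l = lab_lost[OF ca lost]
  obtain H where H: "H \<in> hybrids a" "H \<notin> hybrids b" "lab a b \<in> H" using l(1) by blast
  obtain S T where ST: "S \<noteq> T" "\<And>U. (U, H) \<in> a \<longleftrightarrow> U = S \<or> U = T"
    using hybrid_sides[OF ca H(1)] by metis
  note move = ca H(1) ST
  let ?x = "collapse a H"
  have cx: "cactus ?x" and ax: "system_le a ?x" and hx: "hybrids ?x = hybrids a - {H}"
    and rank: "cactus_rank ?x = cactus_rank a + 1"
    using partition_like_collapse[OF move] le_collapse[OF move] hybrids_collapse[OF move]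
      cactus_rank_collapse[OF move] by simp_all
  have xb: "system_le ?x b" using collapse_le[OF move cb le H(2)] .
  have other: "lab a b \<notin> K" if "K \<in> hybrids a" "K \<noteq> H" for K
    using hybrids_disjoint[OF ca that(1) H(1)] H(3) that(2) by blast
  have lost_x: "\<not> hybrids a \<subseteq> hybrids ?x" "\<Union>(hybrids a - hybrids ?x) = H" using H(1) hx by auto
  have "lab a ?x = lab a b"
  proof (rule antisym)
    show "lab a ?x \<le> lab a b" using lab_lost(3)[OF ca lost_x(1)] lost_x(2) H(3) by simp
    show "lab a b \<le> lab a ?x" using l(3) lab_lost(1)[OF ca lost_x(1)] lost_x(2) H(1,2) by blast
  qed
  moreover have "lab a b < lab ?x b" if "?x \<noteq> b"
  proof (cases "hybrids ?x \<subseteq> hybrids b")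
    case True
    have "n < lab ?x b"
      using lab_gone(2)[OF cx True] lab_new(2)[OF cx cb xb that True] l(2)
      by (cases "minima ?x \<subseteq> minima b") auto
    then show ?thesis using l(2) by simp
  next
    case False
    obtain K where K: "K \<in> hybrids a" "K \<noteq> H" "K \<notin> hybrids b" "lab ?x b \<in> K"
      using lab_lost(1)[OF cx False] hx by blast
    then have "lab a b \<le> lab ?x b" using l(3) by blast
    moreover have "lab a b \<noteq> lab ?x b" using other[OF K(1,2)] K(4) by metis
    ultimately show ?thesis by simp
  qed
  moreover have "system_le ?x y"
    if y: "cactus y" "system_le a y" "a \<noteq> y" "system_le y b" "lab a y = lab a b" for y
  proof -
    have "\<not> hybrids a \<subseteq> hybrids y"
      using lab_gone(2)[OF ca, of y] lab_new(2)[OF ca y(1-3)] l(2) y(5)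
      by (cases "minima a \<subseteq> minima y") auto
    then obtain K where K: "K \<in> hybrids a" "K \<notin> hybrids y" "lab a b \<in> K"
      using lab_lost(1)[OF ca] y(5) by (metis DiffE UnionE)
    then have "K = H" using other by blast
    then show ?thesis using collapse_le[OF move y(1,2)] K(2) by simp
  qed
  ultimately show ?thesis unfolding least_step_def using cx ax xb rank by blast
qed

text \<open>Two blocks of \<open>a\<close> in the same block of \<open>b\<close> may be merged once no triple has to be collapsed. A hybrid of
  \<open>a\<close> is a block of \<open>b\<close> and contains no second block. If both were sides, then of the same hybrid, and
  the other side of this hybrid in \<open>b\<close> would contain neither of them, against (SP2).\<close>

lemma same_block_mergeable:
  assumes ca: "cactus a" and cb: "cactus b" and le: "system_le a b" and kept: "hybrids a \<subseteq> hybrids b"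
    and A: "(A, K) \<in> a" and B: "(B, L) \<in> a" and AB: "A \<noteq> B" and T: "(T, M) \<in> b" "A \<subseteq> T" "B \<subseteq> T"
  shows "A \<notin> hybrids a" "K = {} \<or> L = {}"
proof -
  show "A \<notin> hybrids a"
  proof
    assume "A \<in> hybrids a"
    then have "(A, {}) \<in> b" using kept hybrid_block[OF cb] by blast
    then have "A = T" using same_block[OF cb _ T(1)] T(2) pair_sub(3)[OF ca A] by blast
    then show False using same_block[OF ca A B] T(3) pair_sub(3)[OF ca B] AB by blast
  qed
  show "K = {} \<or> L = {}"
  proof (rule ccontr)
    assume "\<not> (K = {} \<or> L = {})"
    then have ne: "K \<noteq> {}" "L \<noteq> {}" by simp_all
    then have hyb: "K \<in> hybrids a" "L \<in> hybrids a" using A B unfolding hybrids_iff by blast+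
    have eq: "U = T" if "(U, N) \<in> b" "z \<in> U" "z \<in> T" for U N z
      using same_block[OF cb that(1) T(1) that(2,3)] by simp
    have "(T, K) \<in> b"
      using kept_side[OF ca cb le A] hyb(1) kept eq T(2) pair_sub(3)[OF ca A] by blast
    moreover have "(T, L) \<in> b"
      using kept_side[OF ca cb le B] hyb(2) kept eq T(3) pair_sub(3)[OF ca B] by blast
    ultimately have "K = L" using unique_hybrid[OF cb] by simp
    obtain U where U: "U \<noteq> T" "(U, K) \<in> b" using other_side[OF cb \<open>(T, K) \<in> b\<close> ne(1)] by metis
    obtain C where C: "(C, K) \<in> a" "C \<subseteq> U" using le_side[OF ca cb le U(2) hyb(1)] by blast
    obtain B' where "\<And>V. (V, K) \<in> a \<longleftrightarrow> V = A \<or> V = B'" using other_side[OF ca A ne(1)] by metis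
    then have "C = A \<or> C = B" using C(1) B AB \<open>K = L\<close> by metis
    then have "C \<subseteq> T" using T(2,3) by metis
    then show False using eq[OF U(2)] U(1) C(2) pair_sub(3)[OF ca C(1)] by blast
  qed
qed

text \<open>Let \<open>m\<close> be the smallest minimum that has to disappear, \<open>P\<close> its block and \<open>T\<close> the block of \<open>b\<close> around \<open>P\<close>.
  The move merges \<open>P\<close> with the block \<open>Q\<close> that contains \<open>Min T\<close>. Any \<open>y\<close> with the same label has deleted \<open>m\<close>,
  so its block around \<open>P\<close> has a smaller minimum; by the choice of \<open>m\<close> this is a minimum of \<open>b\<close>, hence
  \<open>Min T\<close>, and the block contains \<open>Q\<close> as well.\<close>

lemma least_step_gone:
  assumes ca: "cactus a" and cb: "cactus b" and le: "system_le a b" and kept: "hybrids a \<subseteq> hybrids b"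
    and gone: "\<not> minima a \<subseteq> minima b"
  shows "\<exists>x. least_step a b x"
proof -
  note g = lab_gone[OF ca kept gone]
  define m where "m = lab a b - n"
  have m: "m \<in> minima a" "m \<notin> minima b" "lab a b = n + m" "1 \<le> m" "m \<le> n" using g(1,2) by (auto simp: m_def)
  have m_least: "m \<le> k" if "k \<in> minima a" "k \<notin> minima b" for k using g(3)[of k] that m(3) by simp
  obtain P PK where P: "(P, PK) \<in> a" "m = Min P" using m(1) unfolding minima_iff by blast
  note mP = block_Min[OF ca P(1), folded P(2)]
  obtain T TK where T: "(T, TK) \<in> b" "P \<subseteq> T" using le_pair[OF ca cb le P(1)] by blast
  note mT = block_Min[OF cb T(1)]
  obtain Q QK where Q: "(Q, QK) \<in> a" "Min T \<in> Q" using block_of[OF ca mT(3)] by blast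
  have QT: "Q \<subseteq> T" using le_block[OF ca cb le Q(1) T(1) Q(2) mT(2)] .
  have Min_Q: "Min Q = Min T"
    using Q(2) QT mT(1) block_Min(1,2)[OF ca Q(1)] by (metis Min_le antisym subsetD)
  have Tb: "Min T \<in> minima b" using T(1) unfolding minima_iff by blast
  have PQ: "P \<noteq> Q" using Tb m(2) P(2) Min_Q by metis
  note mergeable = same_block_mergeable[OF ca cb le kept P(1) Q(1) PQ T QT]
    same_block_mergeable[OF ca cb le kept Q(1) P(1) PQ[symmetric] T(1) QT T(2)]
  \<comment> \<open>At most one of \<open>P\<close> and \<open>Q\<close> is a side; it takes the role of \<open>A\<close>.\<close>
  obtain A K B where AB: "(A, K) \<in> a" "(B, {}) \<in> a" "A \<noteq> B" "A \<notin> hybrids a" "B \<notin> hybrids a"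
    "A \<union> B = P \<union> Q" "{A, B} = {P, Q}"
  proof (cases "QK = {}")
    case True
    then show thesis using that[of P PK Q] P(1) Q(1) PQ mergeable by simp
  next
    case False
    then have "PK = {}" using mergeable(2) by simp
    then show thesis
      using that[of Q QK P] P(1) Q(1) PQ mergeable by (simp add: Un_commute insert_commute)
  qed
  note move = ca AB(1-5)
  let ?x = "merge a A K B"
  have cx: "cactus ?x" and ax: "system_le a ?x" and hx: "hybrids ?x = hybrids a"
    and rank: "cactus_rank ?x = cactus_rank a + 1"
    using partition_like_merge[OF move] le_merge[OF move] hybrids_merge[OF move]
      cactus_rank_merge[OF move] by simp_all
  have ABT: "A \<union> B \<subseteq> T" using AB(6) T(2) QT by simp
  have xb: "system_le ?x b" using merge_le[OF move cb le kept T(1) ABT] .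
  have "Min T \<le> m" using mT(1) T(2) mP(2) by (meson Min_le subsetD)
  have "Min (A \<union> B) = Min T"
    using AB(6) block_Min(1)[OF ca P(1)] block_Min(1)[OF ca Q(1)] pair_sub(3)[OF ca P(1)]
      pair_sub(3)[OF ca Q(1)] Min_Un[of P Q] Min_Q P(2) \<open>Min T \<le> m\<close> by simp
  have minima_x: "minima ?x = minima a - {m}"
  proof (rule set_eqI)
    fix k
    show "k \<in> minima ?x \<longleftrightarrow> k \<in> minima a - {m}"
    proof
      assume "k \<in> minima ?x"
      then obtain U L where U: "(U, L) \<in> ?x" "k = Min U" unfolding minima_iff by blast
      from U(1) show "k \<in> minima a - {m}"
        unfolding merge_pair_iff[OF move]
      proof (elim disjE conjE)
        assume "U = A \<union> B"
        then have "k = Min T" using U(2) \<open>Min (A \<union> B) = Min T\<close> by simp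
        moreover have "Min T \<in> minima a" using Q(1) Min_Q unfolding minima_iff by metis
        moreover have "Min T \<noteq> m" using Tb m(2) by metis
        ultimately show ?thesis by simp
      next
        assume U': "(U, L) \<in> a" "U \<noteq> A" "U \<noteq> B"
        then have "U \<noteq> P" using AB(7) by auto
        then have "k \<noteq> m" using Min_unique[OF ca U'(1) P(1)] U(2) P(2) by metis
        moreover have "k \<in> minima a" using U'(1) U(2) unfolding minima_iff by blast
        ultimately show ?thesis by simp
      qed
    next
      assume k: "k \<in> minima a - {m}"
      then obtain U L where U: "(U, L) \<in> a" "k = Min U" unfolding Diff_iff minima_iff by blast
      show "k \<in> minima ?x"
      proof (cases "U = A \<or> U = B")
        case True
        then have "U = P \<or> U = Q" using AB(7) by auto
        then have "k = Min (A \<union> B)" using k U(2) P(2) Min_Q \<open>Min (A \<union> B) = Min T\<close> by auto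
        then show ?thesis unfolding minima_iff merge_pair_iff[OF move] by metis
      next
        case False
        then show ?thesis using U unfolding minima_iff merge_pair_iff[OF move] by metis
      qed
    qed
  qed
  have gone_x: "hybrids a \<subseteq> hybrids ?x" "\<not> minima a \<subseteq> minima ?x" "minima a - minima ?x = {m}"
    using hx minima_x m(1) by auto
  have "lab a ?x = lab a b"
    using lab_gone(1,2)[OF ca gone_x(1,2)] m(3) unfolding gone_x(3) by auto
  moreover have "lab a b < lab ?x b" if "?x \<noteq> b"
  proof (cases "minima ?x \<subseteq> minima b")
    case True
    then show ?thesis using lab_new(2)[OF cx cb xb that] hx kept m(3,5) by simp
  next
    case False
    have kept_x: "hybrids ?x \<subseteq> hybrids b" using hx kept by simp
    have "lab ?x b - n \<in> minima a - {m} - minima b" using lab_gone(1)[OF cx kept_x False] minima_x by simp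
    then have "m < lab ?x b - n" using m_least[of "lab ?x b - n"] by force
    then show ?thesis using m(3) by simp
  qed
  moreover have "system_le ?x y"
    if y: "cactus y" "system_le a y" "a \<noteq> y" "system_le y b" "lab a y = lab a b" for y
  proof -
    have kept_y: "hybrids a \<subseteq> hybrids y" using lab_lost(2)[OF ca, of y] y(5) m(3,4) by fastforce
    then have gone_y: "\<not> minima a \<subseteq> minima y" using lab_new(2)[OF ca y(1-3)] y(5) m(3,5) by fastforce
    have my: "m \<notin> minima y" using lab_gone(1)[OF ca kept_y gone_y] y(5) m(3) by simp
    obtain U L where U: "(U, L) \<in> y" "P \<subseteq> U" using le_pair[OF ca y(1,2) P(1)] by blast
    note mU = block_Min[OF y(1) U(1)]
    have UT: "U \<subseteq> T"
      using le_block[OF y(1) cb y(4) U(1) T(1)] U(2) T(2) mP(2) by blast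
    have Uy: "Min U \<in> minima y" using U(1) unfolding minima_iff by blast
    have "Min U \<le> m" using mU(1) U(2) mP(2) by (meson Min_le subsetD)
    moreover have "Min U \<noteq> m" using my Uy by metis
    moreover have "Min U \<in> minima a" using minima_anti[OF ca y(1,2)] Uy by blast
    ultimately have "Min U \<in> minima b" using m_least[of "Min U"] by fastforce
    then obtain V N where V: "(V, N) \<in> b" "Min U = Min V" unfolding minima_iff by blast
    then have "V = T"
      using same_block[OF cb V(1) T(1), of "Min V"] block_Min(2)[OF cb V(1)] mU(2) UT by fastforce
    then have "Min T \<in> U" using V(2) mU(2) by simp
    then have "Q \<subseteq> U" using le_block[OF ca y(1,2) Q(1) U(1) Q(2)] by simp
    then have "A \<union> B \<subseteq> U" using AB(6) U(2) by simp
    then show ?thesis using merge_le[OF move y(1,2) kept_y U(1)] by simp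
  qed
  ultimately show ?thesis unfolding least_step_def using cx ax xb rank by blast
qed

text \<open>The partitions agree, so the triples of \<open>b\<close> that are missing in \<open>a\<close> consist of blocks of \<open>a\<close>; spawn the
  one whose hybrid contains \<open>lab a b - 2*n\<close>. Any \<open>y\<close> with the same label has the same hybrid \<open>H\<close>, and its
  sides of \<open>H\<close> are those of \<open>b\<close>, since the partitions of \<open>y\<close> and \<open>b\<close> agree too.\<close>

lemma least_step_new:
  assumes ca: "cactus a" and cb: "cactus b" and le: "system_le a b" and ne: "a \<noteq> b"
    and kept: "hybrids a \<subseteq> hybrids b" and same: "minima a \<subseteq> minima b"
  shows "\<exists>x. least_step a b x"
proof -
  note w = lab_new[OF ca cb le ne kept same]
  obtain H where H: "H \<in> hybrids b" "H \<notin> hybrids a" "lab a b - 2*n \<in> H" using w(1) by blast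
  obtain S T where ST: "S \<noteq> T" "\<And>U. (U, H) \<in> b \<longleftrightarrow> U = S \<or> U = T"
    using hybrid_sides[OF cb H(1)] by metis
  have "H \<noteq> {}" using H(1) by (simp add: hybrids_iff)
  have Sb: "(S, H) \<in> b" "(T, H) \<in> b" "(H, {}) \<in> b" using ST(2) hybrid_block[OF cb H(1)] by simp_all
  have block: "\<exists>L. (U, L) \<in> a" if "(U, K) \<in> b" for U K
  proof -
    note mU = block_Min[OF cb that]
    obtain V L where V: "(V, L) \<in> a" "Min U \<in> V" using block_of[OF ca mU(3)] by blast
    have "V = U"
      using same_minima_block[OF ca cb le same V(1) that le_block[OF ca cb le V(1) that V(2) mU(2)]] .
    then show ?thesis using V(1) by metis
  qed
  have no_hybrid: "L = {} \<or> L = K" if L: "(U, L) \<in> a" and K: "(U, K) \<in> b" for U L K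
  proof (cases "L = {}")
    case False
    then have "L \<in> hybrids a" using L unfolding hybrids_iff by blast
    then have "L \<in> hybrids b" using kept by blast
    then obtain V where V: "(V, L) \<in> b" "U \<subseteq> V" using kept_side[OF ca cb le L] by blast
    then show ?thesis using same_block[OF cb V(1) K] pair_sub(3)[OF ca L] by blast
  qed simp
  have not_H: "(U, H) \<notin> a" for U using H(2) \<open>H \<noteq> {}\<close> unfolding hybrids_iff by blast
  have Sa: "(S, {}) \<in> a" "(T, {}) \<in> a" "(H, {}) \<in> a"
    using block[OF Sb(1)] block[OF Sb(2)] block[OF Sb(3)] no_hybrid[OF _ Sb(1)] no_hybrid[OF _ Sb(2)]
      no_hybrid[OF _ Sb(3)] not_H by metis+
  have distinct: "S \<noteq> T" "S \<noteq> H" "T \<noteq> H"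
    using ST(1) pair_sub(4)[OF cb Sb(1)] pair_sub(4)[OF cb Sb(2)] \<open>H \<noteq> {}\<close> by auto
  have free: "S \<notin> hybrids a" "T \<notin> hybrids a"
    using side_not_hybrid[OF cb Sb(1)] side_not_hybrid[OF cb Sb(2)] \<open>H \<noteq> {}\<close> kept by blast+
  note move = ca Sa distinct free H(2)
  let ?x = "spawn a S T H"
  have cx: "cactus ?x" and ax: "system_le a ?x" and hx: "hybrids ?x = insert H (hybrids a)"
    and rank: "cactus_rank ?x = cactus_rank a + 1"
    using partition_like_spawn[OF move] le_spawn[OF move] hybrids_spawn[OF move]
      cactus_rank_spawn[OF move] by simp_all
  have xb: "system_le ?x b" using spawn_le[OF move cb le Sb(1,2)] .
  have other: "lab a b - 2*n \<notin> K" if "K \<in> hybrids b" "K \<noteq> H" for K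
    using hybrids_disjoint[OF cb that(1) H(1)] H(3) that(2) by blast
  have "minima ?x = minima a"
  proof
    show "minima ?x \<subseteq> minima a" using minima_anti[OF ca cx ax] .
    show "minima a \<subseteq> minima ?x" using same minima_anti[OF cx cb xb] by blast
  qed
  moreover have "a \<noteq> ?x" using hx H(2) by auto
  moreover have "hybrids ?x - hybrids a = {H}" using hx H(2) by auto
  ultimately have new_x: "lab a ?x - 2*n \<in> H" "2*n < lab a ?x" "\<And>h. h \<in> H \<Longrightarrow> lab a ?x \<le> 2*n + h"
    using lab_new[OF ca cx ax] hx by auto
  have "lab a ?x = lab a b"
  proof (rule antisym)
    show "lab a ?x \<le> lab a b" using new_x(3)[OF H(3)] w(2) by simp
    show "lab a b \<le> lab a ?x" using w(3)[of "lab a ?x - 2*n"] new_x(1,2) H(1,2) by fastforce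
  qed
  moreover have "lab a b < lab ?x b" if "?x \<noteq> b"
  proof -
    have "hybrids ?x \<subseteq> hybrids b" "minima ?x \<subseteq> minima b"
      using hx H(1) kept \<open>minima ?x = minima a\<close> same by auto
    note wx = lab_new[OF cx cb xb that this]
    obtain K where K: "K \<in> hybrids b" "K \<noteq> H" "K \<notin> hybrids a" "lab ?x b - 2*n \<in> K"
      using wx(1) hx by blast
    then have "lab a b \<le> lab ?x b" using w(3)[of "lab ?x b - 2*n"] wx(2) by fastforce
    moreover have "lab a b \<noteq> lab ?x b" using other[OF K(1,2)] K(4) by metis
    ultimately show ?thesis by simp
  qed
  moreover have "system_le ?x y"
    if y: "cactus y" "system_le a y" "a \<noteq> y" "system_le y b" "lab a y = lab a b" for y
  proof -
    have kept_y: "hybrids a \<subseteq> hybrids y" using lab_lost(2)[OF ca, of y] y(5) w(2) by fastforce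
    have same_y: "minima a \<subseteq> minima y" using lab_gone(2)[OF ca kept_y] y(5) w(2) by fastforce
    have yb: "hybrids y \<subseteq> hybrids b" using hybrids_between[OF ca y(1) cb y(2,4) same] .
    have min_yb: "minima y \<subseteq> minima b" using minima_anti[OF ca y(1,2)] same by blast
    obtain K where K: "K \<in> hybrids y" "lab a b - 2*n \<in> K"
      using lab_new(1)[OF ca y(1-3) kept_y same_y] y(5) by auto
    then have "H \<in> hybrids y" using other[of K] yb by (metis subsetD)
    then obtain P Q where PQ: "P \<noteq> Q" "\<And>U. (U, H) \<in> y \<longleftrightarrow> U = P \<or> U = Q"
      using hybrid_sides[OF y(1)] by metis
    have "(U, H) \<in> b" if U: "(U, H) \<in> y" for U
    proof -
      obtain V where V: "(V, H) \<in> b" "U \<subseteq> V" using kept_side[OF y(1) cb y(4) U H(1)] by blast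
      then have "U = V" using same_minima_block[OF y(1) cb y(4) min_yb U] by simp
      then show ?thesis using V(1) by simp
    qed
    then have "(S, H) \<in> y" "(T, H) \<in> y" using PQ ST by metis+
    then show ?thesis using spawn_le[OF move y(1,2)] by simp
  qed
  ultimately show ?thesis unfolding least_step_def using cx ax xb rank by blast
qed

section \<open>EL-shellability of the poset of ranked cactuses\<close>

lemma least_label_ranked_cactus:
  "least_label_poset (partition_like_systems {1..n}) (ranked_cactus_order {1..n})
    cactus_rank (cactus_label n)"
proof
  show "finite (partition_like_systems {1..n})" by (rule finite_partition_like_systems) simp
  show "partial_order_on (partition_like_systems {1..n}) (ranked_cactus_order {1..n})"
    by (rule partial_order_ranked_cactus)
next
  fix a b assume "(a, b) \<in> ranked_cactus_order {1..n}" and ne: "a \<noteq> b"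
  then have ab: "cactus a" "cactus b" "system_le a b" by (simp_all add: ranked_cactus_order_iff)
  have "\<exists>x. least_step a b x"
    using least_step_lost[OF ab] least_step_gone[OF ab] least_step_new[OF ab ne] by blast
  then obtain x where x: "least_step a b x" ..
  then have "a \<noteq> x" by (auto simp: least_step_def)
  with x ab show "\<exists>x. (a, x) \<in> ranked_cactus_order {1..n} \<and> a \<noteq> x \<and> (x, b) \<in> ranked_cactus_order {1..n} \<and>
      cactus_rank x = cactus_rank a + 1 \<and> lab a x = lab a b \<and> (x \<noteq> b \<longrightarrow> lab a b < lab x b) \<and>
      (\<forall>y. (a, y) \<in> ranked_cactus_order {1..n} \<and> a \<noteq> y \<and> (y, b) \<in> ranked_cactus_order {1..n} \<and>
        lab a y = lab a b \<longrightarrow> (x, y) \<in> ranked_cactus_order {1..n})"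
    unfolding least_step_def ranked_cactus_order_iff by (intro exI[of _ x]) simp
next
  fix a y b assume "(a, y) \<in> ranked_cactus_order {1..n}" "a \<noteq> y" "(y, b) \<in> ranked_cactus_order {1..n}" "y \<noteq> b"
  then show "lab a b \<le> lab a y \<and> (lab a y = lab a b \<or> lab y b \<le> lab a y)"
    using lab_triangle unfolding ranked_cactus_order_iff by blast
qed

end

theorem theorem4p2:
  fixes n :: nat and X :: "nat set"
  assumes "n \<ge> 1" and "X = {1..n}"
  shows "EL_shellable (partition_like_systems X) (ranked_cactus_order X)"
proof -
  have "X \<noteq> {}" using assms by auto
  then have "bounded_poset (partition_like_systems X) (ranked_cactus_order X)"
    by (rule bounded_ranked_cactus)
  then show ?thesis
    unfolding assms(2) by (rule least_label_poset.EL_shellable[OF least_label_ranked_cactus])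
qed

end
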